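(* Let $0<a\le1$, $H=T^a$, $\alpha>0$, and let $f$ be a real-valued even function with $\hat f\in C_c^\infty(\mathbb{R})$ and $\operatorname{supp}\hat f\subset(-\alpha,\alpha)$. Let $w\ge0$ with $\int w=1$ and $\hat w$ compactly supported. Then for every integer $m$ with $2\le m<2a/\alpha$, as $T\to\infty$, $$\langle (N_f^{\mathrm{osc}})^m\rangle_{T,H}=\begin{cases}\dfrac{(2k)!}{k!\,2^k}\sigma_f^{2k}, & m=2k,\\[4pt] 0, & m=2k+1,\end{cases}\;+\;O\Big(\frac1{\log T}\Big),$$ where $\sigma_f^2=\int_{-\infty}^\infty\min(|u|,1)\,\hat f(u)^2\,du$.
   Context: $\hat f(u)=\int f(x)e^{-2\pi ixu}\,dx$. $\Lambda$ is the von Mangoldt function. For real $\tau$, $$N_f^{\mathrm{osc}}(\tau)=-\frac{1}{\log T}\sum_{n\ge2}\frac{\Lambda(n)}{\sqrt n}\hat f\Big(\frac{\log n}{\log T}\Big)\big(e^{i\tau\log n}+e^{-i\tau\log n}\big).$$ For a function $W$ of $\tau$, $\langle W\rangle_{T,H}=\int_{-\infty}^\infty W(\tau)w\big(\frac{\tau-T}{H}\big)\frac{d\tau}{H}$. *)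

theory Defs
  imports "HOL-Analysis.Analysis" "HOL-Number_Theory.Prime_Powers"
begin

definition fourier :: "(real \<Rightarrow> real) \<Rightarrow> real \<Rightarrow> complex" where
  "fourier f u = (LINT x|lborel. complex_of_real (f x) * exp (- 2 * pi * \<i> * complex_of_real (x * u)))"

definition smooth_fun :: "(real \<Rightarrow> complex) \<Rightarrow> bool" where
  "smooth_fun g \<longleftrightarrow>
     (\<forall>k x. ((deriv ^^ k) (\<lambda>t. Re (g t))) differentiable (at x)) \<and>
     (\<forall>k x. ((deriv ^^ k) (\<lambda>t. Im (g t))) differentiable (at x))"

definition supp :: "(real \<Rightarrow> complex) \<Rightarrow> real set" where
  "supp g = closure {u. g u \<noteq> 0}"

definition N_osc :: "(real \<Rightarrow> real) \<Rightarrow> real \<Rightarrow> real \<Rightarrow> complex" where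
  "N_osc f T \<tau> = - (1 / complex_of_real (ln T)) *
     (\<Sum>\<^sub>\<infinity>n\<in>{2::nat..}. (mangoldt n / complex_of_real (sqrt (real n))) *
        fourier f (ln (real n) / ln T) *
        (exp (\<i> * complex_of_real (\<tau> * ln (real n))) + exp (- \<i> * complex_of_real (\<tau> * ln (real n)))))"

definition wavg :: "(real \<Rightarrow> real) \<Rightarrow> real \<Rightarrow> real \<Rightarrow> (real \<Rightarrow> complex) \<Rightarrow> complex" where
  "wavg w T H W = (LINT \<tau>|lborel. W \<tau> * complex_of_real (w ((\<tau> - T) / H) / H))"

definition sigma2 :: "(real \<Rightarrow> real) \<Rightarrow> complex" where
  "sigma2 f = (LINT u|lborel. complex_of_real (min \<bar>u\<bar> 1) * (fourier f u)\<^sup>2)"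

end

theory Submission
  imports Defs "HOL-Library.Poly_Mapping" "HOL-Computational_Algebra.Formal_Power_Series"
    "HOL-Real_Asymp.Real_Asymp"
begin

text \<open>
  For fixed \<open>T\<close> the function \<open>N_osc f T\<close> is a trigonometric polynomial in \<open>\<tau>\<close> with frequencies
  \<open>\<plusminus>ln n\<close>, \<open>n \<le> T powr \<alpha>\<close>. The frequencies of its \<open>m\<close>-th power are \<open>ln (a / b)\<close> with
  \<open>a * b \<le> T powr (m * \<alpha>)\<close>, so the nonzero ones are at least \<open>T powr (- m * \<alpha> / 2) / 2\<close> in modulus.
  As \<open>m * \<alpha> / 2 < a\<close> and the Fourier transform of \<open>w\<close> has bounded support, averaging kills them
  for large \<open>T\<close>: only the constant term survives.

  By unique factorisation the contributions of different primes behave like independent random variables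
  under the constant term functional, so the exponential generating function of the constant
  terms is a product over primes. The factor of \<open>p\<close> is \<open>1 + v p * t\<^sup>2 / 2 + \<dots>\<close>, where the coefficient
  of \<open>t ^ s\<close> is \<open>O((ln p / (ln T * sqrt p)) ^ s)\<close>. Comparing with \<open>exp (v p * t\<^sup>2 / 2)\<close> factor by factor
  shows that the product is \<open>exp (V * t\<^sup>2 / 2)\<close> up to \<open>O(1 / ln T)\<close>, with \<open>V = (\<Sum>p. v p)\<close>, and Mertens'
  theorem with partial summation gives \<open>V = sigma2 f + O(1 / ln T)\<close>.
\<close>

section \<open>Trigonometric polynomials and their constant terms\<close>

text \<open>The trigonometric polynomial \<open>\<Sum>x. c x * cis (\<tau> * x)\<close> is represented by its finitely supported
  coefficient function, so that the ring structure is convolution.\<close>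

abbreviation "coef \<equiv> Poly_Mapping.lookup"
abbreviation "freqs \<equiv> Poly_Mapping.keys"
abbreviation "wave \<equiv> Poly_Mapping.single"

lemma sum_wave: "(\<Sum>x\<in>freqs F. wave x (coef F x)) = F"
proof (rule poly_mapping_eqI)
  fix k
  have "coef (\<Sum>x\<in>freqs F. wave x (coef F x)) k = (\<Sum>x\<in>freqs F. if x = k then coef F x else 0)"
    by (auto simp: lookup_sum lookup_single when_def intro!: sum.cong)
  also have "\<dots> = coef F k" by (auto simp: sum.delta in_keys_iff)
  finally show "coef (\<Sum>x\<in>freqs F. wave x (coef F x)) k = coef F k" .
qed

definition trig_eval :: "real \<Rightarrow> (real \<Rightarrow>\<^sub>0 complex) \<Rightarrow> complex" where
  "trig_eval \<tau> F = (\<Sum>x\<in>freqs F. coef F x * cis (\<tau> * x))"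

lemma trig_eval_superset:
  assumes "finite A" "freqs F \<subseteq> A"
  shows "trig_eval \<tau> F = (\<Sum>x\<in>A. coef F x * cis (\<tau> * x))"
  unfolding trig_eval_def using assms
  by (intro sum.mono_neutral_left) (auto simp: in_keys_iff)

lemma trig_eval_add: "trig_eval \<tau> (F + G) = trig_eval \<tau> F + trig_eval \<tau> G"
proof -
  let ?A = "freqs F \<union> freqs G"
  have "freqs (F + G) \<subseteq> ?A" by (rule keys_add)
  then show ?thesis
    by (simp add: trig_eval_superset[of ?A] lookup_add ring_distribs sum.distrib)
qed

lemma trig_eval_0 [simp]: "trig_eval \<tau> 0 = 0"
  by (simp add: trig_eval_def)

lemma trig_eval_sum: "trig_eval \<tau> (\<Sum>i\<in>I. F i) = (\<Sum>i\<in>I. trig_eval \<tau> (F i))"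
  by (induction I rule: infinite_finite_induct) (auto simp: trig_eval_add)

lemma trig_eval_single [simp]: "trig_eval \<tau> (wave x c) = c * cis (\<tau> * x)"
  by (simp add: trig_eval_def)

text \<open>Expanding both factors into single waves reduces multiplicativity of evaluation,
  submultiplicativity of the norm and the factorisation of constant terms to the case of one wave
  each.\<close>

lemma mult_eq_sum_wave:
  fixes F G :: "real \<Rightarrow>\<^sub>0 complex"
  shows "F * G = (\<Sum>x\<in>freqs F. \<Sum>y\<in>freqs G. wave (x + y) (coef F x * coef G y))"
proof -
  have "F * G = (\<Sum>x\<in>freqs F. wave x (coef F x)) * (\<Sum>y\<in>freqs G. wave y (coef G y))"
    by (simp only: sum_wave)
  also have "\<dots> = (\<Sum>x\<in>freqs F. \<Sum>y\<in>freqs G. wave (x + y) (coef F x * coef G y))"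
    by (simp add: sum_product mult_single)
  finally show ?thesis .
qed

lemma trig_eval_mult: "trig_eval \<tau> (F * G) = trig_eval \<tau> F * trig_eval \<tau> G"
proof -
  have "trig_eval \<tau> (F * G) = (\<Sum>x\<in>freqs F. \<Sum>y\<in>freqs G. coef F x * coef G y * cis (\<tau> * (x + y)))"
    by (subst mult_eq_sum_wave) (simp only: trig_eval_sum trig_eval_single)
  also have "\<dots> = trig_eval \<tau> F * trig_eval \<tau> G"
    by (simp add: trig_eval_def sum_product cis_mult[symmetric] ring_distribs mult_ac)
  finally show ?thesis .
qed

lemma trig_eval_one [simp]: "trig_eval \<tau> 1 = 1"
  by (simp add: trig_eval_def)

lemma trig_eval_power: "trig_eval \<tau> (F ^ m) = trig_eval \<tau> F ^ m"
  by (induction m) (auto simp: trig_eval_mult)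

text \<open>This is the Wiener algebra norm: submultiplicative by \<open>trig_norm_mult\<close> and
  an upper bound for every coefficient by \<open>norm_coef_le\<close>, so it controls the constant
  terms of powers.\<close>

definition trig_norm :: "(real \<Rightarrow>\<^sub>0 complex) \<Rightarrow> real" where
  "trig_norm F = (\<Sum>x\<in>freqs F. cmod (coef F x))"

lemma trig_norm_nonneg: "trig_norm F \<ge> 0"
  by (simp add: trig_norm_def sum_nonneg)

lemma trig_norm_superset:
  assumes "finite A" "freqs F \<subseteq> A"
  shows "trig_norm F = (\<Sum>x\<in>A. cmod (coef F x))"
  unfolding trig_norm_def using assms
  by (intro sum.mono_neutral_left) (auto simp: in_keys_iff)

lemma trig_norm_add: "trig_norm (F + G) \<le> trig_norm F + trig_norm G"
proof -
  let ?A = "freqs F \<union> freqs G"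
  have "freqs (F + G) \<subseteq> ?A" by (rule keys_add)
  then show ?thesis
    by (simp add: trig_norm_superset[of ?A] lookup_add flip: sum.distrib)
       (intro sum_mono norm_triangle_ineq)
qed

lemma trig_norm_0 [simp]: "trig_norm 0 = 0"
  by (simp add: trig_norm_def)

lemma trig_norm_sum: "trig_norm (\<Sum>i\<in>I. F i) \<le> (\<Sum>i\<in>I. trig_norm (F i))"
  by (induction I rule: infinite_finite_induct) (auto intro: order_trans[OF trig_norm_add])

lemma trig_norm_single [simp]: "trig_norm (wave x c) = cmod c"
  by (simp add: trig_norm_def)

lemma trig_norm_mult: "trig_norm (F * G) \<le> trig_norm F * trig_norm G"
proof -
  have "trig_norm (F * G) \<le> (\<Sum>x\<in>freqs F. \<Sum>y\<in>freqs G. trig_norm (wave (x + y) (coef F x * coef G y)))"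
    by (subst mult_eq_sum_wave) (rule order_trans[OF trig_norm_sum] sum_mono trig_norm_sum)+
  also have "\<dots> = trig_norm F * trig_norm G"
    by (simp only: trig_norm_single norm_mult) (simp add: trig_norm_def sum_product)
  finally show ?thesis .
qed

lemma trig_norm_power: "trig_norm (F ^ s) \<le> trig_norm F ^ s"
proof (induction s)
  case 0
  then show ?case by (simp add: trig_norm_def)
next
  case (Suc s)
  have "trig_norm (F ^ Suc s) \<le> trig_norm F * trig_norm (F ^ s)"
    by (simp add: trig_norm_mult)
  also have "\<dots> \<le> trig_norm F ^ Suc s"
    using Suc by (simp add: mult_left_mono trig_norm_nonneg)
  finally show ?case .
qed

lemma norm_coef_le: "cmod (coef F x) \<le> trig_norm F"
proof (cases "x \<in> freqs F")
  case True
  then show ?thesis unfolding trig_norm_def by (intro member_le_sum) auto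
qed (auto simp: in_keys_iff trig_norm_nonneg)

text \<open>A pair of frequencies reaches the constant term only if it sums to 0, and
  \<open>ind\<close> allows this only for the pair (0, 0). The supersets \<open>A\<close> and
  \<open>B\<close> let one pair of additively closed sets serve all powers at once.\<close>

lemma coef_mult_independent:
  fixes F G :: "real \<Rightarrow>\<^sub>0 complex"
  assumes "freqs F \<subseteq> A" "freqs G \<subseteq> B" "0 \<in> A" "0 \<in> B"
    and ind: "\<And>x y. x \<in> A \<Longrightarrow> y \<in> B \<Longrightarrow> x + y = 0 \<Longrightarrow> x = 0 \<and> y = 0"
  shows "coef (F * G) 0 = coef F 0 * coef G 0"
proof -
  have "coef (F * G) 0 = (\<Sum>x\<in>freqs F. \<Sum>y\<in>freqs G. coef (wave (x + y) (coef F x * coef G y)) 0)"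
    by (subst mult_eq_sum_wave) (simp only: lookup_sum)
  also have "\<dots> = (\<Sum>x\<in>freqs F. \<Sum>y\<in>freqs G. (if x = 0 then coef F x else 0) * (if y = 0 then coef G y else 0))"
  proof (intro sum.cong refl)
    fix x y assume "x \<in> freqs F" "y \<in> freqs G"
    with ind[of x y] assms(1,2) have "x + y = 0 \<longleftrightarrow> x = 0 \<and> y = 0" by fastforce
    then show "coef (wave (x + y) (coef F x * coef G y)) 0
        = (if x = 0 then coef F x else 0) * (if y = 0 then coef G y else 0)"
      by (auto simp: lookup_single when_def)
  qed
  also have "\<dots> = (\<Sum>x\<in>freqs F. if x = 0 then coef F x else 0) * (\<Sum>y\<in>freqs G. if y = 0 then coef G y else 0)"
    by (simp only: sum_product)
  also have "\<dots> = coef F 0 * coef G 0"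
    by (auto simp: sum.delta in_keys_iff)
  finally show ?thesis .
qed

lemma freqs_power:
  fixes F :: "real \<Rightarrow>\<^sub>0 complex"
  assumes "freqs F \<subseteq> A" "0 \<in> A" and add: "\<And>x y. x \<in> A \<Longrightarrow> y \<in> A \<Longrightarrow> x + y \<in> A"
  shows "freqs (F ^ s) \<subseteq> A"
proof (induction s)
  case 0
  show ?case using assms by simp
next
  case (Suc s)
  show ?case
  proof
    fix z assume "z \<in> freqs (F ^ Suc s)"
    then obtain x y where "z = x + y" "x \<in> freqs F" "y \<in> freqs (F ^ s)"
      using keys_mult[of F "F ^ s"] by auto
    with Suc assms show "z \<in> A" by (auto intro: add)
  qed
qed

lemma freqs_sum:
  assumes "\<And>i. i \<in> I \<Longrightarrow> freqs (F i) \<subseteq> A"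
  shows "freqs (\<Sum>i\<in>I. F i) \<subseteq> A"
  using assms
proof (induction I rule: infinite_finite_induct)
  case (insert i I)
  then show ?case using keys_add[of "F i" "\<Sum>i\<in>I. F i"] by fastforce
qed auto

text \<open>The constant term plays the role of an expectation: \<open>moment_fps\<close> is a moment generating
  function, and \<open>moment_fps_add\<close> is the product rule for independent summands.\<close>

definition moment_fps :: "(real \<Rightarrow>\<^sub>0 complex) \<Rightarrow> complex fps" where
  "moment_fps F = Abs_fps (\<lambda>n. coef (F ^ n) 0 / fact n)"

lemma moment_fps_0 [simp]: "moment_fps 0 = 1"
  by (rule fps_ext) (auto simp: moment_fps_def lookup_one power_0_left)

lemma moment_fps_add:
  assumes A: "freqs F \<subseteq> A" "0 \<in> A" "\<And>x y. x \<in> A \<Longrightarrow> y \<in> A \<Longrightarrow> x + y \<in> A"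
    and B: "freqs G \<subseteq> B" "0 \<in> B" "\<And>x y. x \<in> B \<Longrightarrow> y \<in> B \<Longrightarrow> x + y \<in> B"
    and ind: "\<And>x y. x \<in> A \<Longrightarrow> y \<in> B \<Longrightarrow> x + y = 0 \<Longrightarrow> x = 0 \<and> y = 0"
  shows "moment_fps (F + G) = moment_fps F * moment_fps G"
proof (rule fps_ext)
  fix n
  have "coef ((F + G) ^ n) 0 = (\<Sum>k\<le>n. coef (of_nat (n choose k) * F ^ k * G ^ (n - k)) 0)"
    by (simp add: binomial_ring lookup_sum)
  also have "\<dots> = (\<Sum>k\<le>n. of_nat (n choose k) * (coef (F ^ k) 0 * coef (G ^ (n - k)) 0))"
  proof (intro sum.cong refl)
    fix k
    have "coef (of_nat (n choose k) * F ^ k * G ^ (n - k)) 0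
        = coef (of_nat (n choose k) * (F ^ k * G ^ (n - k))) 0" by (simp add: mult.assoc)
    \<comment> \<open>The binomial coefficient is a constant, so its only possible frequency is 0
      and it is independent of anything.\<close>
    also have "\<dots> = of_nat (n choose k) * coef (F ^ k * G ^ (n - k)) 0"
      by (subst coef_mult_independent[of _ "{0}" _ UNIV]) (auto simp: lookup_of_nat simp flip: single_of_nat)
    also have "coef (F ^ k * G ^ (n - k)) 0 = coef (F ^ k) 0 * coef (G ^ (n - k)) 0"
      by (intro coef_mult_independent[OF freqs_power[OF A] freqs_power[OF B] A(2) B(2) ind])
    finally show "coef (of_nat (n choose k) * F ^ k * G ^ (n - k)) 0
        = of_nat (n choose k) * (coef (F ^ k) 0 * coef (G ^ (n - k)) 0)" .
  qed
  finally show "fps_nth (moment_fps (F + G)) n = fps_nth (moment_fps F * moment_fps G) n"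
    by (auto simp: moment_fps_def fps_mult_nth binomial_fact sum_divide_distrib field_simps
             atLeast0AtMost intro!: sum.cong)
qed

section \<open>Frequencies of different primes and their independence\<close>

definition prime_freqs :: "nat \<Rightarrow> real set" where
  "prime_freqs p = {of_int k * ln (real p) |k. True}"

text \<open>These are the logarithms of the positive rationals that are units at \<open>p\<close>.
  They form an additive group containing \<open>prime_freqs q\<close> for every prime
  \<open>q \<noteq> p\<close>, so the contribution of all other primes can be treated as one
  summand.\<close>

definition coprime_freqs :: "nat \<Rightarrow> real set" where
  "coprime_freqs p = {ln (real a) - ln (real b) |a b. a > 0 \<and> b > 0 \<and> \<not> p dvd a \<and> \<not> p dvd b}"

lemma prime_freqs_closed: "0 \<in> prime_freqs p"
  "x \<in> prime_freqs p \<Longrightarrow> y \<in> prime_freqs p \<Longrightarrow> x + y \<in> prime_freqs p"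
proof -
  show "0 \<in> prime_freqs p" unfolding prime_freqs_def by (auto intro!: exI[of _ 0])
  assume "x \<in> prime_freqs p" "y \<in> prime_freqs p"
  then obtain k l where "x = of_int k * ln (real p)" "y = of_int l * ln (real p)"
    unfolding prime_freqs_def by auto
  then have "x + y = of_int (k + l) * ln (real p)" by (simp add: ring_distribs)
  then show "x + y \<in> prime_freqs p" unfolding prime_freqs_def by blast
qed

lemma coprime_freqs_closed:
  assumes "prime p"
  shows "0 \<in> coprime_freqs p"
  "x \<in> coprime_freqs p \<Longrightarrow> y \<in> coprime_freqs p \<Longrightarrow> x + y \<in> coprime_freqs p"
proof -
  have "\<not> p dvd 1" using assms not_prime_unit by blast
  then show "0 \<in> coprime_freqs p" unfolding coprime_freqs_def by (auto intro!: exI[of _ 1])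
  assume "x \<in> coprime_freqs p" "y \<in> coprime_freqs p"
  then obtain a b c d where *: "x = ln (real a) - ln (real b)" "y = ln (real c) - ln (real d)"
    "a > 0" "b > 0" "c > 0" "d > 0" "\<not> p dvd a" "\<not> p dvd b" "\<not> p dvd c" "\<not> p dvd d"
    unfolding coprime_freqs_def by auto
  then have "x + y = ln (real (a * c)) - ln (real (b * d))" by (simp add: ln_mult)
  moreover have "\<not> p dvd a * c" "\<not> p dvd b * d" using * assms by (auto simp: prime_dvd_mult_iff)
  ultimately show "x + y \<in> coprime_freqs p" unfolding coprime_freqs_def using *
    by (intro CollectI exI[of _ "a * c"] exI[of _ "b * d"]) auto
qed

lemma prime_power_mult_not_dvd:
  fixes a b p k :: nat
  assumes "prime p" "\<not> p dvd b" "p ^ k * a = b"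
  shows "k = 0"
  using assms by (metis dvd_mult2 dvd_power not_gr_zero)

text \<open>Exponentiating \<open>x + y = 0\<close> gives \<open>p ^ k * a = b\<close>, or the same
  with \<open>a\<close> and \<open>b\<close> exchanged if \<open>k\<close> is negative. As
  \<open>p\<close> divides neither \<open>a\<close> nor \<open>b\<close>, the exponent is 0.\<close>

lemma prime_coprime_freqs_independent:
  assumes p: "prime p" and "x \<in> prime_freqs p" "y \<in> coprime_freqs p" "x + y = 0"
  shows "x = 0 \<and> y = 0"
proof -
  obtain k a b where *: "x = of_int k * ln (real p)" "y = ln (real a) - ln (real b)"
     "a > 0" "b > 0" "\<not> p dvd a" "\<not> p dvd b"
    using assms unfolding coprime_freqs_def prime_freqs_def by auto
  have p0: "p > 0" using p prime_gt_0_nat by blast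
  have aux: "j = 0" if "real j * ln (real p) + ln (real c) = ln (real d)" "c > 0" "d > 0" "\<not> p dvd d"
    for j c d :: nat
  proof -
    have "ln (real (p ^ j * c)) = ln (real d)"
      using that p0 by (simp add: ln_mult ln_realpow)
    then have "real (p ^ j * c) = real d"
      using that p0 by (subst (asm) ln_inj_iff) auto
    then have "p ^ j * c = d" by (simp only: of_nat_eq_iff)
    then show ?thesis using prime_power_mult_not_dvd[OF p that(4)] by blast
  qed
  have "k = 0"
  proof (cases "k \<ge> 0")
    case True
    then show ?thesis using aux[of "nat k" a b] * assms(4) by simp
  next
    case False
    then show ?thesis using aux[of "nat (-k)" b a] * assms(4) by simp
  qed
  then show ?thesis using * assms(4) by auto
qed

lemma prime_freqs_subset_coprime_freqs:
  assumes "prime p" "prime q" "p \<noteq> q"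
  shows "prime_freqs q \<subseteq> coprime_freqs p"
proof
  fix x assume "x \<in> prime_freqs q"
  then obtain k where x: "x = of_int k * ln (real q)" unfolding prime_freqs_def by auto
  have nd: "\<not> p dvd q ^ j" for j
    using assms by (metis prime_dvd_power primes_dvd_imp_eq)
  have nd1: "\<not> p dvd 1" using assms not_prime_unit by blast
  have q0: "q > 0" using assms prime_gt_0_nat by blast
  show "x \<in> coprime_freqs p"
  proof (cases "k \<ge> 0")
    case True
    then have "x = ln (real (q ^ nat k)) - ln (real 1)" using x q0 by (simp add: ln_realpow)
    then show ?thesis unfolding coprime_freqs_def using nd nd1 q0
      by (intro CollectI exI[of _ "q ^ nat k"] exI[of _ "1::nat"]) auto
  next
    case False
    then have "x = ln (real 1) - ln (real (q ^ nat (-k)))" using x q0 by (simp add: ln_realpow)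
    then show ?thesis unfolding coprime_freqs_def using nd nd1 q0
      by (intro CollectI exI[of _ "q ^ nat (-k)"] exI[of _ "1::nat"]) auto
  qed
qed

text \<open>Induction splits off one prime \<open>p\<close>; the sum over the remaining ones lives
  on \<open>coprime_freqs p\<close>, which makes it independent of \<open>F p\<close>.\<close>

lemma moment_fps_sum:
  assumes "finite P" "\<And>p. p \<in> P \<Longrightarrow> prime p" "\<And>p. p \<in> P \<Longrightarrow> freqs (F p) \<subseteq> prime_freqs p"
  shows "moment_fps (\<Sum>p\<in>P. F p) = (\<Prod>p\<in>P. moment_fps (F p))"
  using assms
proof (induction P rule: finite_induct)
  case (insert p P)
  have p: "prime p" using insert by auto
  have "freqs (\<Sum>q\<in>P. F q) \<subseteq> coprime_freqs p"
  proof (rule freqs_sum)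
    fix q assume "q \<in> P"
    then show "freqs (F q) \<subseteq> coprime_freqs p"
      using insert prime_freqs_subset_coprime_freqs[of p q] by (metis insertCI order_trans)
  qed
  then have "moment_fps (F p + (\<Sum>q\<in>P. F q)) = moment_fps (F p) * moment_fps (\<Sum>q\<in>P. F q)"
    using insert by (intro moment_fps_add[OF _ prime_freqs_closed _ coprime_freqs_closed[OF p]
        prime_coprime_freqs_independent[OF p]]) auto
  then show ?case using insert by simp
qed auto

section \<open>Products of power series close to Gaussian ones\<close>

text \<open>Truncation at order \<open>m\<close> keeps the sum finite and still gives a
  submultiplicative norm, because coefficients of a product up to order \<open>m\<close> involve
  only coefficients up to order \<open>m\<close>.\<close>

definition fps_tnorm :: "nat \<Rightarrow> complex fps \<Rightarrow> real" where
  "fps_tnorm m F = (\<Sum>i\<le>m. cmod (fps_nth F i))"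

lemma fps_tnorm_nonneg: "fps_tnorm m F \<ge> 0"
  by (simp add: fps_tnorm_def sum_nonneg)

lemma fps_tnorm_one [simp]: "fps_tnorm m 1 = 1"
proof -
  have "fps_tnorm m 1 = (\<Sum>i\<le>m. if i = 0 then 1 else 0)"
    unfolding fps_tnorm_def by (intro sum.cong) auto
  then show ?thesis by simp
qed

lemma fps_tnorm_add: "fps_tnorm m (F + G) \<le> fps_tnorm m F + fps_tnorm m G"
  unfolding fps_tnorm_def sum.distrib[symmetric]
  by (intro sum_mono) (simp add: norm_triangle_ineq)

lemma fps_tnorm_mult: "fps_tnorm m (F * G) \<le> fps_tnorm m F * fps_tnorm m G"
proof -
  let ?h = "\<lambda>i j. cmod (fps_nth F i) * cmod (fps_nth G j)"
  have "fps_tnorm m (F * G) \<le> (\<Sum>k\<le>m. \<Sum>i\<le>k. ?h i (k - i))"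
    unfolding fps_tnorm_def
    by (intro sum_mono) (auto simp: fps_mult_nth atLeast0AtMost norm_mult intro!: order_trans[OF norm_sum])
  also have "\<dots> = (\<Sum>(i, j)\<in>{(i, j). i + j \<le> m}. ?h i j)"
    by (rule sum.triangle_reindex_eq[symmetric])
  also have "\<dots> \<le> (\<Sum>(i, j)\<in>{..m} \<times> {..m}. ?h i j)"
    by (intro sum_mono2) auto
  also have "\<dots> = fps_tnorm m F * fps_tnorm m G"
    unfolding fps_tnorm_def sum_product sum.cartesian_product ..
  finally show ?thesis .
qed

text \<open>From \<open>1 + x \<le> exp x\<close>; it turns bounds for products over primes into
  exponentials of sums over primes.\<close>

lemma fps_tnorm_le_exp: "fps_tnorm m F \<le> exp (fps_tnorm m (F - 1))"
proof -
  have "fps_tnorm m F \<le> fps_tnorm m 1 + fps_tnorm m (F - 1)"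
    using fps_tnorm_add[of m 1 "F - 1"] by simp
  also have "\<dots> \<le> exp (fps_tnorm m (F - 1))" by simp
  finally show ?thesis .
qed

lemma fps_tnorm_prod:
  "finite P \<Longrightarrow> fps_tnorm m (\<Prod>p\<in>P. a p) \<le> exp (\<Sum>p\<in>P. fps_tnorm m (a p - 1))"
proof (induction P rule: finite_induct)
  case (insert p P)
  have "fps_tnorm m (a p * prod a P) \<le> fps_tnorm m (a p) * fps_tnorm m (prod a P)"
    by (rule fps_tnorm_mult)
  also have "\<dots> \<le> exp (fps_tnorm m (a p - 1)) * exp (\<Sum>p\<in>P. fps_tnorm m (a p - 1))"
    using insert by (intro mult_mono fps_tnorm_le_exp fps_tnorm_nonneg) auto
  finally show ?case using insert by (simp add: exp_add)
qed auto

text \<open>The factors \<open>a p\<close> are exchanged for \<open>b p\<close> one at a time. Each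
  exchange costs the norm of \<open>a p - b p\<close> times a product of other factors, which the
  exponential bounds uniformly.\<close>

lemma fps_tnorm_prod_diff:
  "finite P \<Longrightarrow> fps_tnorm m ((\<Prod>p\<in>P. a p) - (\<Prod>p\<in>P. b p)) \<le>
     (\<Sum>p\<in>P. fps_tnorm m (a p - b p)) *
     exp (\<Sum>p\<in>P. fps_tnorm m (a p - 1) + fps_tnorm m (b p - 1))"
proof (induction P rule: finite_induct)
  case empty
  then show ?case by (simp add: fps_tnorm_def)
next
  case (insert p P)
  let ?S = "\<lambda>c P. \<Sum>p\<in>P. fps_tnorm m (c p - 1)"
  let ?D = "\<Sum>p\<in>P. fps_tnorm m (a p - b p)"
  let ?E = "exp (?S a (insert p P) + ?S b (insert p P))"
  have nn: "?S c P' \<ge> 0" for c P' by (intro sum_nonneg fps_tnorm_nonneg)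
  have "prod a (insert p P) - prod b (insert p P)
      = (a p - b p) * prod a P + b p * (prod a P - prod b P)"
    using insert by (simp add: algebra_simps)
  then have "fps_tnorm m (prod a (insert p P) - prod b (insert p P))
      \<le> fps_tnorm m ((a p - b p) * prod a P) + fps_tnorm m (b p * (prod a P - prod b P))"
    by (simp only: fps_tnorm_add)
  also have "\<dots> \<le> fps_tnorm m (a p - b p) * fps_tnorm m (prod a P)
        + fps_tnorm m (b p) * fps_tnorm m (prod a P - prod b P)"
    by (intro add_mono fps_tnorm_mult)
  also have "fps_tnorm m (a p - b p) * fps_tnorm m (prod a P) \<le> fps_tnorm m (a p - b p) * ?E"
  proof (intro mult_left_mono fps_tnorm_nonneg)
    have "?S a P \<le> ?S a (insert p P) + ?S b (insert p P)"
      using insert nn[of b P] fps_tnorm_nonneg[of m "a p - 1"] fps_tnorm_nonneg[of m "b p - 1"] by simp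
    then show "fps_tnorm m (prod a P) \<le> ?E"
      using fps_tnorm_prod[of P m a] insert by (meson exp_le_cancel_iff order_trans)
  qed
  also have "fps_tnorm m (b p) * fps_tnorm m (prod a P - prod b P) \<le> ?D * ?E"
  proof -
    have "fps_tnorm m (b p) * fps_tnorm m (prod a P - prod b P)
        \<le> exp (fps_tnorm m (b p - 1)) * (?D * exp (?S a P + ?S b P))"
      using insert by (intro mult_mono fps_tnorm_le_exp fps_tnorm_nonneg) (auto simp: sum.distrib)
    also have "\<dots> = ?D * exp (fps_tnorm m (b p - 1) + ?S a P + ?S b P)"
      by (simp add: exp_add mult_ac)
    also have "\<dots> \<le> ?D * ?E"
      using insert fps_tnorm_nonneg[of m "a p - 1"]
      by (intro mult_left_mono sum_nonneg fps_tnorm_nonneg) auto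
    finally show ?thesis .
  qed
  finally show ?case
    using insert by (simp only: sum.distrib) (simp add: ring_distribs)
qed

text \<open>The exponential moment generating function \<open>exp (v t\<^sup>2 / 2)\<close> of a centred Gaussian
  of variance \<open>v\<close>.\<close>

definition gauss_fps :: "complex \<Rightarrow> complex fps" where
  "gauss_fps v = Abs_fps (\<lambda>n. if even n then (v / 2) ^ (n div 2) / fact (n div 2) else 0)"

text \<open>In this form the additivity of variances is inherited from the functional equation of
  the exponential series.\<close>

lemma gauss_fps_conv: "gauss_fps v = fps_exp (v / 2) oo fps_X ^ 2"
proof (rule fps_ext)
  fix n
  have "fps_nth (fps_exp (v / 2) oo fps_X ^ 2) n
      = (\<Sum>i=0..n. if n = 2 * i then (v / 2) ^ i / fact i else 0)"
    by (auto simp: fps_compose_nth simp flip: power_mult intro!: sum.cong)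
  also have "\<dots> = fps_nth (gauss_fps v) n"
  proof (cases "even n")
    case True
    then obtain k where n: "n = 2 * k" by auto
    have "(\<Sum>i=0..n. if n = 2 * i then (v / 2) ^ i / fact i else 0)
        = (\<Sum>i=0..n. if i = k then (v / 2) ^ i / fact i else 0)"
      by (intro sum.cong) (auto simp: n)
    then show ?thesis using n by (simp add: gauss_fps_def)
  next
    case False
    then have "\<And>i. n \<noteq> 2 * i" by auto
    then show ?thesis using False by (simp add: gauss_fps_def)
  qed
  finally show "fps_nth (gauss_fps v) n = fps_nth (fps_exp (v / 2) oo fps_X ^ 2) n" by simp
qed

lemma gauss_fps_add: "gauss_fps (v + w) = gauss_fps v * gauss_fps w"
  unfolding gauss_fps_conv
  by (subst fps_compose_mult_distrib[symmetric]) (auto simp: add_divide_distrib simp flip: fps_exp_add_mult)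

lemma gauss_fps_sum: "finite P \<Longrightarrow> gauss_fps (\<Sum>p\<in>P. v p) = (\<Prod>p\<in>P. gauss_fps (v p))"
proof (induction P rule: finite_induct)
  case empty
  show ?case by (simp add: gauss_fps_conv)
qed (auto simp: gauss_fps_add)

text \<open>The variance \<open>2 * fps_nth (g p) 2\<close> makes \<open>g p\<close> agree with its
  Gaussian factor through order 2. Hence their difference is of size \<open>q p ^ 3\<close>, while
  each of them differs from 1 by at most a multiple of \<open>q p ^ 2\<close>;
  \<open>fps_tnorm_prod_diff\<close> combines the two. In \<open>K\<close>, the factor
  \<open>m + 1\<close> counts coefficients and 2 counts the series being compared.\<close>

lemma fps_prod_near_gauss:
  fixes g :: "nat \<Rightarrow> complex fps" and q :: "nat \<Rightarrow> real" and Q :: real and m :: nat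
  assumes fin: "finite P"
    and q: "\<And>p. p \<in> P \<Longrightarrow> 0 \<le> q p" "\<And>p. p \<in> P \<Longrightarrow> q p \<le> Q"
    and g0: "\<And>p. p \<in> P \<Longrightarrow> fps_nth (g p) 0 = 1"
    and g1: "\<And>p. p \<in> P \<Longrightarrow> fps_nth (g p) 1 = 0"
    and gs: "\<And>p s. p \<in> P \<Longrightarrow> s \<ge> 2 \<Longrightarrow> cmod (fps_nth (g p) s) \<le> q p ^ s"
  defines "K \<equiv> 2 * real (m + 1) * (1 + Q) ^ m"
  shows "cmod (fps_nth (\<Prod>p\<in>P. g p) m - fps_nth (gauss_fps (\<Sum>p\<in>P. 2 * fps_nth (g p) 2)) m)
       \<le> K * (\<Sum>p\<in>P. q p ^ 3) * exp (K * (\<Sum>p\<in>P. q p ^ 2))"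
proof (cases "P = {}")
  case True
  then show ?thesis by (auto simp: gauss_fps_def)
next
  case False
  then have Q0: "Q \<ge> 0" using q by (meson all_not_in_conv order_trans)
  define e where "e p = gauss_fps (2 * fps_nth (g p) 2)" for p
  have e0: "fps_nth (e p) 0 = 1" "fps_nth (e p) 1 = 0" "fps_nth (e p) 2 = fps_nth (g p) 2" for p
    by (auto simp: e_def gauss_fps_def)
  have es: "cmod (fps_nth (e p) s) \<le> q p ^ s" if "p \<in> P" for p s
  proof (cases "even s")
    case True
    then obtain k where s: "s = 2 * k" by auto
    have "cmod (fps_nth (e p) s) = cmod (fps_nth (g p) 2) ^ k / fact k"
      by (simp add: e_def gauss_fps_def s norm_divide norm_power)
    also have "\<dots> \<le> cmod (fps_nth (g p) 2) ^ k / 1"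
      by (intro divide_left_mono) auto
    also have "\<dots> \<le> (q p ^ 2) ^ k"
      using gs[OF that, of 2] by (auto intro: power_mono)
    finally show ?thesis by (simp add: s power_mult)
  qed (use q that in \<open>auto simp: e_def gauss_fps_def\<close>)
  \<comment> \<open>Surplus powers of \<open>q p\<close> are absorbed into the constant, so that
    only the lowest occurring power (2 or 3) remains.\<close>
  have pw: "q p ^ s \<le> (1 + Q) ^ m * q p ^ r" if "p \<in> P" "r \<le> s" "s \<le> m" for p s r
  proof -
    have "q p ^ s = q p ^ (s - r) * q p ^ r" using that by (simp flip: power_add)
    also have "\<dots> \<le> (1 + Q) ^ m * q p ^ r"
    proof (intro mult_right_mono)
      have "q p ^ (s - r) \<le> (1 + Q) ^ (s - r)" using that q[of p] by (intro power_mono) auto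
      also have "\<dots> \<le> (1 + Q) ^ m" using that Q0 by (intro power_increasing) auto
      finally show "q p ^ (s - r) \<le> (1 + Q) ^ m" .
    qed (use q that in auto)
    finally show ?thesis .
  qed
  have d: "fps_tnorm m (g p - e p) \<le> K * q p ^ 3" if p: "p \<in> P" for p
  proof -
    have "cmod (fps_nth (g p - e p) s) \<le> 2 * ((1 + Q) ^ m * q p ^ 3)" if "s \<le> m" for s
    proof (cases "s \<ge> 3")
      case True
      then have "cmod (fps_nth (g p - e p) s) \<le> 2 * q p ^ s"
        using norm_triangle_ineq4[of "fps_nth (g p) s" "fps_nth (e p) s"] es[OF p, of s] gs[OF p, of s] by simp
      then show ?thesis using pw[OF p True that] by linarith
    next
      case False
      then have "s = 0 \<or> s = 1 \<or> s = 2" by auto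
      then have "fps_nth (g p - e p) s = 0" using e0[of p] g0[OF p] g1[OF p] by auto
      then show ?thesis using Q0 q p by auto
    qed
    then have "fps_tnorm m (g p - e p) \<le> (\<Sum>s\<le>m. 2 * ((1 + Q) ^ m * q p ^ 3))"
      unfolding fps_tnorm_def by (intro sum_mono) auto
    then show ?thesis by (simp add: K_def algebra_simps)
  qed
  have o: "fps_tnorm m (h - 1) \<le> K / 2 * q p ^ 2"
    if p: "p \<in> P" and h: "fps_nth h 0 = 1" "fps_nth h 1 = 0" "\<And>s. s \<ge> 2 \<Longrightarrow> cmod (fps_nth h s) \<le> q p ^ s" for p h
  proof -
    have "cmod (fps_nth (h - 1) s) \<le> (1 + Q) ^ m * q p ^ 2" if "s \<le> m" for s
    proof (cases "s \<ge> 2")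
      case True
      then show ?thesis using h(3)[OF True] pw[OF p True that] by auto
    next
      case False
      then have "s = 0 \<or> s = 1" by auto
      then have "fps_nth (h - 1) s = 0" using h by auto
      then show ?thesis using Q0 q p by auto
    qed
    then have "fps_tnorm m (h - 1) \<le> (\<Sum>s\<le>m. (1 + Q) ^ m * q p ^ 2)"
      unfolding fps_tnorm_def by (intro sum_mono) auto
    then show ?thesis by (simp add: K_def algebra_simps)
  qed
  have oo: "fps_tnorm m (g p - 1) + fps_tnorm m (e p - 1) \<le> K * q p ^ 2" if "p \<in> P" for p
    using o[OF that g0[OF that] g1[OF that] gs[OF that]] o[OF that e0(1,2) es[OF that]]
    by (auto simp: field_simps)
  have "cmod (fps_nth (\<Prod>p\<in>P. g p) m - fps_nth (gauss_fps (\<Sum>p\<in>P. 2 * fps_nth (g p) 2)) m)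
      = cmod (fps_nth ((\<Prod>p\<in>P. g p) - (\<Prod>p\<in>P. e p)) m)"
    using fin by (simp add: gauss_fps_sum e_def)
  also have "\<dots> \<le> fps_tnorm m ((\<Prod>p\<in>P. g p) - (\<Prod>p\<in>P. e p))"
    unfolding fps_tnorm_def by (rule member_le_sum) auto
  also have "\<dots> \<le> (\<Sum>p\<in>P. fps_tnorm m (g p - e p)) *
     exp (\<Sum>p\<in>P. fps_tnorm m (g p - 1) + fps_tnorm m (e p - 1))"
    by (rule fps_tnorm_prod_diff[OF fin])
  also have "\<dots> \<le> (\<Sum>p\<in>P. K * q p ^ 3) * exp (\<Sum>p\<in>P. K * q p ^ 2)"
    using oo d by (intro mult_mono sum_mono sum_nonneg)
      (auto intro!: sum_mono fps_tnorm_nonneg mult_nonneg_nonneg simp: K_def Q0 q)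
  finally show ?thesis by (simp add: sum_distrib_left)
qed

section \<open>Mertens' first theorem\<close>

lemma sum_primepow_decompose:
  fixes h :: "nat \<Rightarrow> 'a :: comm_monoid_add"
  assumes np: "\<And>n. \<not> primepow n \<Longrightarrow> h n = 0" and big: "\<And>n. n > N \<Longrightarrow> h n = 0"
  shows "(\<Sum>n\<le>N. h n) = (\<Sum>p | prime p \<and> p \<le> N. \<Sum>k=1..N. h (p ^ k))"
proof -
  let ?P = "{p. prime p \<and> p \<le> N}"
  let ?A = "{(p, k). prime p \<and> p \<le> N \<and> k \<in> {1..N} \<and> p ^ k \<le> N}"
  have "(\<Sum>p\<in>?P. \<Sum>k=1..N. h (p ^ k)) = (\<Sum>(p, k)\<in>?P \<times> {1..N}. h (p ^ k))"
    by (simp add: sum.cartesian_product)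
  also have "\<dots> = (\<Sum>(p, k)\<in>?A. h (p ^ k))"
    by (intro sum.mono_neutral_right) (auto intro: big simp: not_le)
  also have "\<dots> = (\<Sum>n\<in>(\<lambda>(p, k). p ^ k) ` ?A. h n)"
    by (subst sum.reindex) (auto simp: inj_on_def prime_power_inj'' case_prod_unfold)
  also have "(\<lambda>(p, k). p ^ k) ` ?A = {n. n \<le> N \<and> primepow n}"
  proof (intro equalityI subsetI)
    fix n assume "n \<in> {n. n \<le> N \<and> primepow n}"
    then obtain p k where pk: "prime p" "k > 0" "n = p ^ k" "n \<le> N"
      by (auto simp: primepow_def)
    have "p \<ge> 2" using pk prime_ge_2_nat by blast
    have "k < 2 ^ k" by simp
    also have "(2::nat) ^ k \<le> p ^ k" using \<open>p \<ge> 2\<close> by (rule power_mono) auto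
    finally have "k \<le> N" using pk by simp
    moreover have "p \<le> N"
      using self_le_power[of p k] pk \<open>p \<ge> 2\<close> by simp
    ultimately show "n \<in> (\<lambda>(p, k). p ^ k) ` ?A" using pk by force
  qed auto
  also have "(\<Sum>n | n \<le> N \<and> primepow n. h n) = (\<Sum>n\<le>N. h n)"
    by (intro sum.mono_neutral_left) (auto intro: np)
  finally show ?thesis by simp
qed

text \<open>Passing from \<open>N\<close> to \<open>N + 1\<close> raises \<open>N div d\<close> by
  one exactly at the divisors \<open>d\<close> of \<open>N + 1\<close>, whose von Mangoldt values
  add up to \<open>ln (N + 1)\<close>.\<close>

lemma ln_fact_eq_sum_mangoldt: "ln (fact N :: real) = (\<Sum>d=1..N. mangoldt d * real (N div d))"
proof (induction N)
  case 0
  show ?case by simp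
next
  case (Suc N)
  have "(\<Sum>d=1..Suc N. mangoldt d * real (Suc N div d))
      = (\<Sum>d=1..Suc N. mangoldt d * real (N div d) + (if d dvd Suc N then mangoldt d else 0))"
    by (intro sum.cong refl) (auto simp: div_Suc dvd_eq_mod_eq_0 ring_distribs)
  also have "\<dots> = (\<Sum>d=1..N. mangoldt d * real (N div d)) + (\<Sum>d\<in>{1..Suc N} \<inter> {d. d dvd Suc N}. mangoldt d)"
    by (simp add: sum.distrib sum.inter_restrict)
  also have "{1..Suc N} \<inter> {d. d dvd Suc N} = {d. d dvd Suc N}"
    by (auto dest: dvd_imp_le intro!: Nat.gr0I simp: Suc_le_eq)
  also have "(\<Sum>d | d dvd Suc N. mangoldt d :: real) = ln (real (Suc N))"
    using mangoldt_sum[of "Suc N", where ?'a = real] by simp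
  finally show ?case using Suc by (simp add: ln_mult)
qed

text \<open>Chebyshev's argument: the logarithm of the central binomial coefficient weights
  \<open>mangoldt d\<close> with \<open>2 * n div d - 2 * (n div d)\<close>, which is never negative
  and equals 1 for \<open>n < d \<le> 2 * n\<close>; the coefficient itself is at most
  \<open>2 ^ (2 * n)\<close>.\<close>

lemma sum_mangoldt_dyadic: "(\<Sum>d=n+1..2*n. mangoldt d) \<le> 2 * real n * ln 2"
proof -
  have "(\<Sum>d=n+1..2*n. mangoldt d) \<le> (\<Sum>d=1..2*n. mangoldt d * (real (2 * n div d) - 2 * real (n div d)))"
  proof -
    have "(\<Sum>d=n+1..2*n. mangoldt d) = (\<Sum>d=n+1..2*n. mangoldt d * (real (2 * n div d) - 2 * real (n div d)))"
    proof (intro sum.cong refl)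
      fix d assume d: "d \<in> {n+1..2*n}"
      then have "2 * n div d = 1" by (intro div_nat_eqI) auto
      moreover have "n div d = 0" using d by auto
      ultimately show "mangoldt d = mangoldt d * (real (2 * n div d) - 2 * real (n div d))" by simp
    qed
    also have "\<dots> \<le> (\<Sum>d=1..2*n. mangoldt d * (real (2 * n div d) - 2 * real (n div d)))"
    proof (intro sum_mono2 mult_nonneg_nonneg mangoldt_nonneg)
      fix d
      have "2 * (n div d) \<le> 2 * n div d"
        by (cases "d = 0") (auto simp: less_eq_div_iff_mult_less_eq)
      then have "real (2 * (n div d)) \<le> real (2 * n div d)" by (rule of_nat_mono)
      then show "0 \<le> real (2 * n div d) - 2 * real (n div d)" by simp
    qed auto
    finally show ?thesis .
  qed
  also have "\<dots> = (\<Sum>d=1..2*n. mangoldt d * real (2 * n div d)) - 2 * (\<Sum>d=1..2*n. mangoldt d * real (n div d))"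
    by (simp add: sum_subtractf sum_distrib_left algebra_simps)
  also have "(\<Sum>d=1..2*n. mangoldt d * real (n div d)) = (\<Sum>d=1..n. mangoldt d * real (n div d))"
    by (intro sum.mono_neutral_right) auto
  also have "(\<Sum>d=1..2*n. mangoldt d * real (2 * n div d)) - 2 * (\<Sum>d=1..n. mangoldt d * real (n div d))
      = ln (fact (2 * n)) - 2 * ln (fact n)"
    by (simp only: ln_fact_eq_sum_mangoldt)
  also have "\<dots> = ln (real (2 * n choose n))"
  proof -
    have "real (2 * n choose n) = fact (2 * n) / (fact n * fact n)"
      using binomial_fact[of n "2 * n", where ?'a = real] by simp
    then show ?thesis by (simp add: ln_div ln_mult)
  qed
  also have "\<dots> \<le> ln (real (2 ^ (2 * n)))"
    by (subst ln_le_cancel_iff) (auto simp del: of_nat_power intro!: binomial_le_pow2)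
  also have "\<dots> = 2 * real n * ln 2" by (simp add: ln_realpow)
  finally show ?thesis .
qed

lemma sum_mangoldt_le: "(\<Sum>d=1..N. mangoldt d) \<le> 6 * real N"
proof (induction N rule: less_induct)
  case (less N)
  show ?case
  proof (cases "N \<ge> 2")
    case False
    then have "N = 0 \<or> N = 1" by auto
    then show ?thesis by auto
  next
    case True
    \<comment> \<open>Rounding up ensures \<open>N \<le> 2 * n\<close>. The induction then closes
      because \<open>8 * n \<le> 4 * N + 4 \<le> 6 * N\<close> for \<open>N \<ge> 2\<close>.\<close>
    define n where "n = (N + 1) div 2"
    have n: "n < N" "N \<le> 2 * n" "2 * n \<le> N + 1" using True by (auto simp: n_def)
    have "(\<Sum>d=1..N. mangoldt d :: real) \<le> (\<Sum>d=1..2*n. mangoldt d)"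
      using n by (intro sum_mono2 mangoldt_nonneg) auto
    also have "{1..2*n} = {1..n} \<union> {n+1..2*n}" by auto
    also have "(\<Sum>d\<in>{1..n} \<union> {n+1..2*n}. mangoldt d :: real) = (\<Sum>d=1..n. mangoldt d) + (\<Sum>d=n+1..2*n. mangoldt d)"
      by (intro sum.union_disjoint) auto
    also have "\<dots> \<le> 6 * real n + 2 * real n * ln 2"
      using less n sum_mangoldt_dyadic[of n] by (intro add_mono) auto
    also have "\<dots> \<le> 6 * real n + 2 * real n * 1"
      using ln_2_less_1 by (intro add_mono mult_left_mono) auto
    also have "\<dots> \<le> 6 * real N" using n True by linarith
    finally show ?thesis .
  qed
qed

text \<open>\<open>N ^ N / fact N\<close> is a single term of the exponential series at
  \<open>N\<close>.\<close>

lemma ln_fact_ge: "N > 0 \<Longrightarrow> ln (fact N :: real) \<ge> real N * ln (real N) - real N"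
proof -
  assume N: "N > 0"
  have "real N ^ N / fact N = (\<Sum>n\<in>{N}. real N ^ n /\<^sub>R fact n)" by (simp add: field_simps)
  also have "\<dots> \<le> suminf (\<lambda>n. real N ^ n /\<^sub>R fact n)"
    by (intro sum_le_suminf summable_exp_generic) auto
  also have "\<dots> = exp (real N)" by (simp add: exp_def)
  finally have "ln (real N ^ N / fact N) \<le> ln (exp (real N))"
    using N by (subst ln_le_cancel_iff) auto
  then show ?thesis using N by (simp add: ln_div ln_realpow)
qed

text \<open>Replacing \<open>N / d\<close> by \<open>N div d + 1\<close> yields
  \<open>ln (fact N)\<close> plus an error that Chebyshev's bound \<open>sum_mangoldt_le\<close>
  makes linear in \<open>N\<close>.\<close>

lemma sum_mangoldt_over_upper:
  assumes "N > 0"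
  shows "(\<Sum>d=1..N. mangoldt d / real d) \<le> ln (real N) + 6"
proof -
  have "real N * (\<Sum>d=1..N. mangoldt d / real d) = (\<Sum>d=1..N. mangoldt d * (real N / real d))"
    by (simp add: sum_distrib_left mult_ac)
  also have "\<dots> \<le> (\<Sum>d=1..N. mangoldt d * (real (N div d) + 1))"
  proof (intro sum_mono mult_left_mono mangoldt_nonneg)
    fix d assume d: "d \<in> {1..N}"
    have "N \<le> d * (N div d + 1)" using d dividend_less_times_div[of d N] by simp
    then have "real N \<le> real (d * (N div d + 1))" by (simp only: of_nat_le_iff)
    then show "real N / real d \<le> real (N div d) + 1"
      using d by (simp add: field_simps)
  qed
  also have "\<dots> = ln (fact N) + (\<Sum>d=1..N. mangoldt d)"
    by (simp add: ln_fact_eq_sum_mangoldt ring_distribs sum.distrib)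
  also have "\<dots> \<le> real N * ln (real N) + 6 * real N"
  proof (intro add_mono sum_mangoldt_le)
    have "(fact N :: real) \<le> real N ^ N" using fact_le_power[of N, where ?'a = real] by simp
    then have "ln (fact N :: real) \<le> ln (real N ^ N)"
      using assms by (subst ln_le_cancel_iff) auto
    then show "ln (fact N :: real) \<le> real N * ln (real N)" using assms by (simp add: ln_realpow)
  qed
  also have "\<dots> = real N * (ln (real N) + 6)" by (simp add: algebra_simps)
  finally show ?thesis using assms by (simp add: mult_le_cancel_left_pos)
qed

lemma sum_mangoldt_over_lower:
  assumes "N > 0"
  shows "(\<Sum>d=1..N. mangoldt d / real d) \<ge> ln (real N) - 1"
proof -
  have "real N * (ln (real N) - 1) \<le> ln (fact N)"
    using ln_fact_ge[OF assms] by (simp add: algebra_simps)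
  also have "\<dots> \<le> (\<Sum>d=1..N. mangoldt d * (real N / real d))"
    unfolding ln_fact_eq_sum_mangoldt
    by (intro sum_mono mult_left_mono mangoldt_nonneg of_nat_div_le_of_nat)
  also have "\<dots> = real N * (\<Sum>d=1..N. mangoldt d / real d)"
    by (simp add: sum_distrib_left mult_ac)
  finally show ?thesis using assms by (simp add: mult_le_cancel_left_pos)
qed

text \<open>Any exponent strictly between 1 and 3/2 would do for the comparison. All convergent
  prime sums below have this shape: \<open>s = 1\<close> for higher prime powers in Mertens'
  theorem, \<open>s = 2\<close> for the variance, \<open>s = 3\<close> for the cubes of
  \<open>q\<close>.\<close>

lemma summable_ln_power_over: "summable (\<lambda>n. ln (real n) ^ s / (real n * sqrt (real n)))"
proof (rule summable_comparison_test_bigo)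
  show "summable (\<lambda>n. norm (real n powr (-5/4)))"
    by (simp add: summable_real_powr_iff)
  show "(\<lambda>n. ln (real n) ^ s / (real n * sqrt (real n))) \<in> O(\<lambda>n. real n powr (-5/4))"
    by real_asymp
qed

definition ln_power_const :: "nat \<Rightarrow> real" where
  "ln_power_const s = suminf (\<lambda>n. ln (real n) ^ s / (real n * sqrt (real n)))"

lemma sum_ln_power_over_le:
  assumes "finite A"
  shows "(\<Sum>n\<in>A. ln (real n) ^ s / (real n * sqrt (real n))) \<le> ln_power_const s"
  unfolding ln_power_const_def
proof (intro sum_le_suminf summable_ln_power_over assms)
  fix n :: nat
  have "ln (real n) \<ge> 0" by (cases "n = 0") auto
  then show "0 \<le> ln (real n) ^ s / (real n * sqrt (real n))" by simp
qed

lemma sum_geometric_tail_le: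
  fixes x :: real
  assumes "0 \<le> x" "x < 1"
  shows "(\<Sum>k=j..N. x ^ k) \<le> x ^ j / (1 - x)"
proof -
  have "(\<Sum>k=j..N. x ^ k) \<le> (\<Sum>i<Suc N. x ^ (i + j))"
  proof -
    have "(\<Sum>k=j..N. x ^ k) = (\<Sum>i\<in>{i. i + j \<le> N}. x ^ (i + j))"
      by (rule sum.reindex_bij_witness[of _ "\<lambda>i. i + j" "\<lambda>k. k - j"]) auto
    also have "\<dots> \<le> (\<Sum>i<Suc N. x ^ (i + j))"
      using assms by (intro sum_mono2) auto
    finally show ?thesis .
  qed
  also have "\<dots> = x ^ j * (\<Sum>i<Suc N. x ^ i)" by (simp add: power_add sum_distrib_left mult_ac del: sum.lessThan_Suc)
  also have "\<dots> \<le> x ^ j * (1 / (1 - x))"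
  proof (intro mult_left_mono)
    have "(\<Sum>i<Suc N. x ^ i) = (1 - x ^ Suc N) / (1 - x)" using assms by (subst sum_gp_strict) auto
    also have "\<dots> \<le> 1 / (1 - x)" using assms by (intro divide_right_mono) auto
    finally show "(\<Sum>i<Suc N. x ^ i) \<le> 1 / (1 - x)" .
  qed (use assms in auto)
  finally show ?thesis by simp
qed

text \<open>The von Mangoldt sum exceeds the prime sum by the proper prime powers. These are
  nonnegative, which gives the upper bound, and their total is bounded by a convergent series, which
  gives the lower one.\<close>

lemma mertens_first_nat: "\<exists>C. \<forall>N>0. \<bar>(\<Sum>p | prime p \<and> p \<le> N. ln (real p) / real p) - ln (real N)\<bar> \<le> C"
proof -
  define C where "C = 7 + 2 * ln_power_const 1"
  have "\<bar>(\<Sum>p | prime p \<and> p \<le> N. ln (real p) / real p) - ln (real N)\<bar> \<le> C" if N: "N > 0" for N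
  proof -
    let ?P = "{p. prime p \<and> p \<le> N}"
    have fin: "finite ?P" by simp
    have c0: "ln_power_const 1 \<ge> 0" using sum_ln_power_over_le[of "{}" 1] by simp
    have "(\<Sum>p\<in>?P. ln (real p) / real p) = (\<Sum>p\<in>?P. mangoldt p / real p)"
      by (intro sum.cong) auto
    also have "\<dots> \<le> (\<Sum>d=1..N. mangoldt d / real d)"
      by (intro sum_mono2) (auto simp: mangoldt_nonneg Suc_le_eq prime_gt_0_nat)
    finally have up: "(\<Sum>p\<in>?P. ln (real p) / real p) \<le> ln (real N) + 6"
      using sum_mangoldt_over_upper[OF N] by linarith
    define h where "h n = (if n \<le> N then mangoldt n / real n else 0)" for n
    have "(\<Sum>d=1..N. mangoldt d / real d) = (\<Sum>n\<le>N. h n)"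
      by (intro sum.mono_neutral_cong_left) (auto simp: h_def not_le)
    also have "\<dots> = (\<Sum>p\<in>?P. \<Sum>k=1..N. h (p ^ k))"
      by (rule sum_primepow_decompose) (auto simp: h_def mangoldt_def)
    also have "\<dots> \<le> (\<Sum>p\<in>?P. ln (real p) / real p + 2 * (ln (real p) ^ 1 / (real p * sqrt (real p))))"
    proof (intro sum_mono)
      fix p assume "p \<in> ?P"
      then have p: "prime p" "p \<ge> 2" "p \<le> N" using prime_ge_2_nat by auto
      have lnp: "ln (real p) \<ge> 0" using p by auto
      have "(\<Sum>k=1..N. h (p ^ k)) \<le> (\<Sum>k=1..N. ln (real p) * (1 / real p) ^ k)"
        using p lnp by (intro sum_mono) (auto simp: h_def field_simps)
      also have "\<dots> = ln (real p) / real p + ln (real p) * (\<Sum>k=2..N. (1 / real p) ^ k)"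
        using N by (subst sum.atLeast_Suc_atMost) (auto simp: sum_distrib_left numeral_2_eq_2)
      also have "\<dots> \<le> ln (real p) / real p + ln (real p) * ((1 / real p) ^ 2 / (1 - 1 / real p))"
        using p lnp by (intro add_mono mult_left_mono sum_geometric_tail_le) auto
      also have "\<dots> \<le> ln (real p) / real p + ln (real p) * (2 / (real p * sqrt (real p)))"
      proof (intro add_left_mono mult_left_mono lnp)
        have "(1 / real p) ^ 2 / (1 - 1 / real p) \<le> (1 / real p) ^ 2 / (1 / 2)"
          using p by (intro divide_left_mono) (auto simp: field_simps)
        also have "\<dots> = 2 / (real p * real p)" by (simp add: power2_eq_square)
        \<comment> \<open>The exponent 2 is weakened to 3/2 so that \<open>ln_power_const\<close>
          applies.\<close>
        also have "\<dots> \<le> 2 / (real p * sqrt (real p))"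
        proof (intro divide_left_mono mult_left_mono)
          show "sqrt (real p) \<le> real p" using p by (intro real_le_lsqrt) (auto simp: power2_eq_square)
        qed (use p in auto)
        finally show "(1 / real p) ^ 2 / (1 - 1 / real p) \<le> 2 / (real p * sqrt (real p))" .
      qed
      finally show "(\<Sum>k=1..N. h (p ^ k)) \<le> ln (real p) / real p + 2 * (ln (real p) ^ 1 / (real p * sqrt (real p)))"
        by (simp add: mult.commute)
    qed
    also have "\<dots> = (\<Sum>p\<in>?P. ln (real p) / real p) + 2 * (\<Sum>p\<in>?P. ln (real p) ^ 1 / (real p * sqrt (real p)))"
      by (simp add: sum.distrib sum_distrib_left)
    also have "\<dots> \<le> (\<Sum>p\<in>?P. ln (real p) / real p) + 2 * ln_power_const 1"
      using sum_ln_power_over_le[OF fin, of 1] by simp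
    finally have "ln (real N) - 1 - 2 * ln_power_const 1 \<le> (\<Sum>p\<in>?P. ln (real p) / real p)"
      using sum_mangoldt_over_lower[OF N] by linarith
    then show ?thesis using up c0 unfolding C_def by linarith
  qed
  then show ?thesis by blast
qed

text \<open>With \<open>N\<close> the integer part of \<open>exp t\<close>, the chain
  \<open>exp t < N + 1 \<le> 2 * N \<le> exp 1 * N\<close> shows that rounding changes the logarithm
  by at most 1.\<close>

lemma mertens_first_real:
  "\<exists>C\<ge>0. \<forall>t\<ge>0. \<bar>(\<Sum>p | prime p \<and> ln (real p) \<le> t. ln (real p) / real p) - t\<bar> \<le> C"
proof -
  obtain C where C: "\<And>N. N > 0 \<Longrightarrow> \<bar>(\<Sum>p | prime p \<and> p \<le> N. ln (real p) / real p) - ln (real N)\<bar> \<le> C"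
    using mertens_first_nat by blast
  have C0: "C \<ge> 0" using C[of 1] by linarith
  have "\<bar>(\<Sum>p | prime p \<and> ln (real p) \<le> t. ln (real p) / real p) - t\<bar> \<le> C + 1" if t: "t \<ge> 0" for t
  proof -
    define N where "N = nat \<lfloor>exp t\<rfloor>"
    have e1: "exp t \<ge> 1" using t by simp
    have N: "N > 0" "real N \<le> exp t" "exp t < real N + 1"
      unfolding N_def using e1 by linarith+
    have "ln (real N) \<le> t" using N ln_le_cancel_iff[of "real N" "exp t"] by simp
    moreover have "t \<le> ln (real N) + 1"
    proof -
      have "exp t \<le> 2 * real N" using N by linarith
      also have "\<dots> \<le> exp 1 * real N" using exp_ge_add_one_self[of 1] by (intro mult_right_mono) auto
      finally have "t \<le> ln (exp 1 * real N)" using N by (subst ln_ge_iff) auto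
      then show ?thesis using N by (simp add: ln_mult)
    qed
    moreover have "{p. prime p \<and> ln (real p) \<le> t} = {p. prime p \<and> p \<le> N}"
    proof -
      have "ln (real p) \<le> t \<longleftrightarrow> p \<le> N" if "prime p" for p
      proof -
        have "ln (real p) \<le> t \<longleftrightarrow> real p \<le> exp t"
          using prime_gt_0_nat[OF that] ln_le_cancel_iff[of "real p" "exp t"] by simp
        also have "\<dots> \<longleftrightarrow> p \<le> N" unfolding N_def by (simp add: le_nat_floor le_floor_iff le_nat_iff)
        finally show ?thesis .
      qed
      then show ?thesis by blast
    qed
    ultimately show ?thesis using C[OF N(1)] by simp
  qed
  then show ?thesis using C0 by (intro exI[of _ "C + 1"]) auto
qed

section \<open>The variance\<close>

text \<open>Partial summation against Mertens' theorem. The error is at most the Mertens constant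
  times the supremum of the modulus of \<open>h'\<close> times the length \<alpha>;
  \<open>van\<close> removes the boundary terms.\<close>

lemma sum_over_primes_asymp:
  fixes h h' :: "real \<Rightarrow> complex"
  assumes \<alpha>: "\<alpha> > 0"
    and der: "\<And>u. u \<in> {0..\<alpha>} \<Longrightarrow> (h has_vector_derivative h' u) (at u within {0..\<alpha>})"
    and cont: "continuous_on {0..\<alpha>} h'"
    and van: "h \<alpha> = 0"
  shows "\<exists>C. \<forall>L>0. cmod ((\<Sum>p | prime p \<and> ln (real p) \<le> \<alpha> * L. of_real (ln (real p) / real p) * h (ln (real p) / L))
            - of_real L * integral {0..\<alpha>} h) \<le> C"
proof -
  obtain C where C: "C \<ge> 0" "\<And>t. t \<ge> 0 \<Longrightarrow> \<bar>(\<Sum>p | prime p \<and> ln (real p) \<le> t. ln (real p) / real p) - t\<bar> \<le> C"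
    using mertens_first_real by blast
  have "bounded (h' ` {0..\<alpha>})"
    by (intro compact_imp_bounded compact_continuous_image cont compact_Icc)
  then obtain B where B: "\<And>u. u \<in> {0..\<alpha>} \<Longrightarrow> cmod (h' u) \<le> B"
    unfolding bounded_iff by blast
  have B0: "B \<ge> 0" using B[of 0] \<alpha> norm_ge_zero[of "h' 0"] by (meson atLeastAtMost_iff less_imp_le order.refl order_trans)
  have hc: "continuous_on {0..\<alpha>} h"
    using der by (rule continuous_on_vector_derivative)
  have "cmod ((\<Sum>p | prime p \<and> ln (real p) \<le> \<alpha> * L. of_real (ln (real p) / real p) * h (ln (real p) / L))
            - of_real L * integral {0..\<alpha>} h) \<le> C * B * \<alpha>" if L: "L > 0" for L
  proof -
    define P where "P = {p. prime p \<and> ln (real p) \<le> \<alpha> * L}"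
    define a where "a p = ln (real p) / real p" for p :: nat
    have finP: "finite P"
    proof (rule finite_subset)
      show "P \<subseteq> {..nat \<lceil>exp (\<alpha> * L)\<rceil>}"
      proof
        fix p assume "p \<in> P"
        then have p: "p > 0" "ln (real p) \<le> \<alpha> * L" by (auto simp: P_def prime_gt_0_nat)
        then have "real p \<le> exp (\<alpha> * L)" using ln_le_cancel_iff[of "real p" "exp (\<alpha> * L)"] by simp
        then show "p \<in> {..nat \<lceil>exp (\<alpha> * L)\<rceil>}" by (simp add: le_nat_iff) linarith
      qed
    qed auto
    have y: "0 \<le> ln (real p) / L" "ln (real p) / L \<le> \<alpha>" if "p \<in> P" for p
    proof -
      have "real p \<ge> 1" using that prime_ge_1_nat[of p] by (auto simp: P_def)
      then show "0 \<le> ln (real p) / L" "ln (real p) / L \<le> \<alpha>" using that L by (auto simp: P_def field_simps)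
    qed
    have I1: "((\<lambda>u. if ln (real p) / L \<le> u then h' u else 0) has_integral - h (ln (real p) / L)) {0..\<alpha>}" if "p \<in> P" for p
    proof -
      let ?y = "ln (real p) / L"
      have "(h' has_integral (h \<alpha> - h ?y)) {?y..\<alpha>}"
      proof (rule fundamental_theorem_of_calculus)
        fix x assume "x \<in> {?y..\<alpha>}"
        then show "(h has_vector_derivative h' x) (at x within {?y..\<alpha>})"
          using y[OF that] by (intro has_vector_derivative_within_subset[OF der]) auto
      qed (use y[OF that] in auto)
      then have "((\<lambda>u. if u \<in> {?y..\<alpha>} then h' u else 0) has_integral - h ?y) {0..\<alpha>}"
        using y[OF that] by (subst has_integral_restrict) (auto simp: van)
      then show ?thesis by (rule has_integral_eq[rotated]) auto
    qed
    have I2: "((\<lambda>u. \<Sum>p\<in>P. of_real (a p) * (if ln (real p) / L \<le> u then h' u else 0)) has_integral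
        (\<Sum>p\<in>P. of_real (a p) * - h (ln (real p) / L))) {0..\<alpha>}"
      by (intro has_integral_sum finP has_integral_mult_right I1)
    \<comment> \<open>Each \<open>h (ln p / L)\<close> is minus an integral of \<open>h'\<close>, so the sum is minus the integral of \<open>h'\<close> against
      the Mertens sum at \<open>L * u\<close>; replacing the latter by \<open>L * u\<close> costs a bounded factor.\<close>
    have I3: "((\<lambda>u. h u + of_real u * h' u) has_integral (of_real \<alpha> * h \<alpha> - of_real 0 * h 0)) {0..\<alpha>}"
    proof (rule fundamental_theorem_of_calculus)
      fix x assume x: "x \<in> {0..\<alpha>}"
      show "((\<lambda>u. of_real u * h u) has_vector_derivative h x + of_real x * h' x) (at x within {0..\<alpha>})"
        by (rule derivative_eq_intros der x refl | simp)+
    qed (use \<alpha> in auto)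
    have hi: "(h has_integral integral {0..\<alpha>} h) {0..\<alpha>}"
      using hc by (intro integrable_integral integrable_continuous_interval)
    \<comment> \<open>Integration by parts, both boundary values of \<open>u * h u\<close> being
      0.\<close>
    have I4: "((\<lambda>u. of_real u * h' u) has_integral - integral {0..\<alpha>} h) {0..\<alpha>}"
      using has_integral_diff[OF I3 hi] by (simp add: van)
    have I5: "((\<lambda>u. (\<Sum>p\<in>P. of_real (a p) * (if ln (real p) / L \<le> u then h' u else 0)) - of_real L * (of_real u * h' u))
        has_integral ((\<Sum>p\<in>P. of_real (a p) * - h (ln (real p) / L)) - of_real L * - integral {0..\<alpha>} h)) {0..\<alpha>}"
      by (intro has_integral_diff I2 has_integral_mult_right I4)
    have "cmod ((\<Sum>p\<in>P. of_real (a p) * - h (ln (real p) / L)) - of_real L * - integral {0..\<alpha>} h)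
        \<le> C * B * measure lborel {0..\<alpha>}"
    proof (rule has_integral_bound_real[OF _ finite.emptyI I5])
      show "0 \<le> C * B" using C B0 by simp
      fix u assume "u \<in> {0..\<alpha>} - {}"
      then have u: "u \<in> {0..\<alpha>}" "u \<ge> 0" by auto
      have "(\<Sum>p\<in>P. of_real (a p) * (if ln (real p) / L \<le> u then h' u else 0))
          = (\<Sum>p\<in>P. (if ln (real p) / L \<le> u then of_real (a p) * h' u else 0))"
        by (intro sum.cong) auto
      also have "\<dots> = (\<Sum>p\<in>{p \<in> P. ln (real p) / L \<le> u}. of_real (a p) * h' u)"
        using finP by (simp add: sum.inter_filter)
      \<comment> \<open>As \<open>u \<le> \<alpha>\<close>, the cutoff in \<open>P\<close> is
        implied, and the complete Mertens sum at \<open>L * u\<close> appears.\<close>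
      also have "{p \<in> P. ln (real p) / L \<le> u} = {p. prime p \<and> ln (real p) \<le> L * u}"
      proof -
        have le: "L * u \<le> L * \<alpha>" using u L by simp
        show ?thesis using L by (auto simp: P_def field_simps intro: order_trans[OF _ le])
      qed
      also have "(\<Sum>p | prime p \<and> ln (real p) \<le> L * u. of_real (a p) * h' u)
          = of_real (\<Sum>p | prime p \<and> ln (real p) \<le> L * u. a p) * h' u"
        by (simp add: sum_distrib_right)
      finally have "(\<Sum>p\<in>P. of_real (a p) * (if ln (real p) / L \<le> u then h' u else 0)) - of_real L * (of_real u * h' u)
          = of_real ((\<Sum>p | prime p \<and> ln (real p) \<le> L * u. a p) - L * u) * h' u"
        by (simp add: algebra_simps)
      then have "cmod ((\<Sum>p\<in>P. of_real (a p) * (if ln (real p) / L \<le> u then h' u else 0)) - of_real L * (of_real u * h' u))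
          = \<bar>(\<Sum>p | prime p \<and> ln (real p) \<le> L * u. a p) - L * u\<bar> * cmod (h' u)"
        by (simp only: norm_mult norm_of_real)
      also have "\<dots> \<le> C * B"
        using C(2)[of "L * u"] L u B[of u] C(1) unfolding a_def by (intro mult_mono) auto
      finally show "cmod ((\<Sum>p\<in>P. of_real (a p) * (if ln (real p) / L \<le> u then h' u else 0)) - of_real L * (of_real u * h' u)) \<le> C * B" .
    qed
    also have "(\<Sum>p\<in>P. of_real (a p) * - h (ln (real p) / L)) - of_real L * - integral {0..\<alpha>} h
      = - ((\<Sum>p\<in>P. of_real (a p) * h (ln (real p) / L)) - of_real L * integral {0..\<alpha>} h)"
      by (simp add: sum_negf)
    finally show ?thesis using \<alpha> by (simp only: norm_minus_cancel) (simp add: P_def a_def)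
  qed
  then show ?thesis by blast
qed

lemma fourier_even:
  assumes "\<And>x. f (- x) = f x"
  shows "fourier f (- u) = fourier f u"
  unfolding fourier_def
  by (subst lborel_integral_real_affine[of "-1" _ 0]) (auto simp: assms)

text \<open>The case \<open>k = 0\<close> provides the derivatives of the real and imaginary parts,
  and \<open>k = 1\<close> their continuity.\<close>

lemma smooth_fun_has_vector_derivative:
  assumes "smooth_fun g"
  obtains g' where "\<And>u. (g has_vector_derivative g' u) (at u)" "continuous_on UNIV g'"
proof -
  let ?R = "\<lambda>t. Re (g t)" and ?I = "\<lambda>t. Im (g t)"
  have d0: "?R differentiable (at x)" "?I differentiable (at x)" for x
    using assms unfolding smooth_fun_def by (metis funpow_0)+
  have d1: "deriv ?R differentiable (at x)" "deriv ?I differentiable (at x)" for x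
  proof -
    have "((deriv ^^ 1) ?R) differentiable (at x)" "((deriv ^^ 1) ?I) differentiable (at x)"
      using assms unfolding smooth_fun_def by blast+
    then show "deriv ?R differentiable (at x)" "deriv ?I differentiable (at x)" by simp_all
  qed
  define g' where "g' u = of_real (deriv ?R u) + \<i> * of_real (deriv ?I u)" for u
  have "(g has_vector_derivative g' u) (at u)" for u
  proof -
    have "(?R has_field_derivative deriv ?R u) (at u)" "(?I has_field_derivative deriv ?I u) (at u)"
      using d0 by (simp_all add: DERIV_deriv_iff_real_differentiable)
    then have "((\<lambda>t. of_real (?R t) + \<i> * of_real (?I t)) has_vector_derivative g' u) (at u)"
      unfolding g'_def by (intro has_vector_derivative_add has_vector_derivative_mult_right has_vector_derivative_of_real)
    then show ?thesis by (simp flip: complex_eq)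
  qed
  moreover have "continuous_on UNIV g'"
    unfolding g'_def
    by (intro continuous_intros differentiable_imp_continuous_on)
       (auto simp: differentiable_on_def d1)
  ultimately show ?thesis using that by blast
qed

text \<open>Evenness folds the integral onto the positive half line, and
  \<open>\<alpha> \<le> 1\<close> makes the minimum equal to \<open>u\<close> wherever the transform
  is nonzero.\<close>

lemma sigma2_eq:
  assumes \<alpha>: "0 < \<alpha>" "\<alpha> \<le> 1"
    and ev: "\<And>x. f (- x) = f x"
    and cont: "continuous_on UNIV (fourier f)"
    and van: "\<And>u. \<bar>u\<bar> \<ge> \<alpha> \<Longrightarrow> fourier f u = 0"
  shows "sigma2 f = 2 * integral {0..\<alpha>} (\<lambda>u. of_real u * (fourier f u)\<^sup>2)"
proof -
  let ?k = "\<lambda>u. complex_of_real (min \<bar>u\<bar> 1) * (fourier f u)\<^sup>2"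
  have kc: "continuous_on A ?k" for A
    by (intro continuous_intros continuous_on_subset[OF cont]) auto
  have si: "set_integrable lborel {-\<alpha>..\<alpha>} ?k"
    by (intro borel_integrable_atLeastAtMost' kc)
  have "sigma2 f = (LINT u:{-\<alpha>..\<alpha>}|lborel. ?k u)"
    unfolding sigma2_def set_lebesgue_integral_def
    by (intro Bochner_Integration.integral_cong refl) (auto simp: indicator_def van)
  also have "\<dots> = integral {-\<alpha>..\<alpha>} ?k"
    using set_borel_integral_eq_integral(2)[OF si] .
  also have "\<dots> = integral {-\<alpha>..0} ?k + integral {0..\<alpha>} ?k"
    using \<alpha> by (intro Henstock_Kurzweil_Integration.integral_combine[symmetric] integrable_continuous_interval kc) auto
  also have "integral {-\<alpha>..0} ?k = integral {-\<alpha>..-0} (\<lambda>u. ?k (- u))"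
    by (simp add: fourier_even[of f, OF ev])
  also have "\<dots> = integral {0..\<alpha>} ?k"
    by (rule Henstock_Kurzweil_Integration.integral_reflect_real)
  also have "integral {0..\<alpha>} ?k = integral {0..\<alpha>} (\<lambda>u. of_real u * (fourier f u)\<^sup>2)"
    using \<alpha> by (intro Henstock_Kurzweil_Integration.integral_cong) auto
  finally show ?thesis by simp
qed

text \<open>Splitting \<open>(ln p)\<^sup>2 / (p * L\<^sup>2)\<close> as \<open>1 / L\<close> times
  \<open>ln p / p\<close> times \<open>ln p / L\<close> brings the sum into the form of
  \<open>sum_over_primes_asymp\<close> with \<open>h u = u * (fourier f u)\<^sup>2\<close>. The
  bounded error there is divided by \<open>L\<close> here.\<close>

lemma fourier_variance_over_primes:
  assumes \<alpha>: "0 < \<alpha>" "\<alpha> \<le> 1"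
    and ev: "\<And>x. f (- x) = f x"
    and smooth: "smooth_fun (fourier f)"
    and van: "\<And>u. \<bar>u\<bar> \<ge> \<alpha> \<Longrightarrow> fourier f u = 0"
  shows "\<exists>C. \<forall>L>0. cmod ((\<Sum>p | prime p \<and> ln (real p) \<le> \<alpha> * L.
            2 * (of_real (ln (real p) / (sqrt (real p) * L)) * fourier f (ln (real p) / L))\<^sup>2)
            - sigma2 f) \<le> C / L"
proof -
  obtain D where D: "\<And>u. (fourier f has_vector_derivative D u) (at u)" "continuous_on UNIV D"
    using smooth_fun_has_vector_derivative[OF smooth] by blast
  have cont: "continuous_on A (fourier f)" for A
    using D(1) by (meson continuous_at_imp_continuous_on has_vector_derivative_continuous)
  define h where "h u = of_real u * (fourier f u)\<^sup>2" for u
  define h' where "h' u = (fourier f u)\<^sup>2 + of_real u * (2 * fourier f u * D u)" for u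
  have "(h has_vector_derivative h' u) (at u within {0..\<alpha>})" for u
  proof -
    have "((\<lambda>u. of_real u * (fourier f u * fourier f u)) has_vector_derivative h' u) (at u within {0..\<alpha>})"
      unfolding h'_def
      by (rule derivative_eq_intros has_vector_derivative_at_within[OF D(1)] refl
          | simp add: power2_eq_square algebra_simps)+
    then show ?thesis by (simp add: h_def[abs_def] power2_eq_square)
  qed
  moreover have "continuous_on {0..\<alpha>} h'"
    unfolding h'_def by (intro continuous_intros cont continuous_on_subset[OF D(2)]) auto
  moreover have "h \<alpha> = 0" using van[of \<alpha>] \<alpha> by (simp add: h_def)
  ultimately obtain C where C: "\<And>L. L > 0 \<Longrightarrow>
      cmod ((\<Sum>p | prime p \<and> ln (real p) \<le> \<alpha> * L. of_real (ln (real p) / real p) * h (ln (real p) / L))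
            - of_real L * integral {0..\<alpha>} h) \<le> C"
    using sum_over_primes_asymp[OF \<alpha>(1), of h h'] by blast
  have sig: "sigma2 f = 2 * integral {0..\<alpha>} h"
    unfolding h_def by (rule sigma2_eq[OF \<alpha> ev cont van])
  have "cmod ((\<Sum>p | prime p \<and> ln (real p) \<le> \<alpha> * L.
            2 * (of_real (ln (real p) / (sqrt (real p) * L)) * fourier f (ln (real p) / L))\<^sup>2)
            - sigma2 f) \<le> 2 * C / L" if L: "L > 0" for L
  proof -
    let ?P = "{p. prime p \<and> ln (real p) \<le> \<alpha> * L}"
    have "(\<Sum>p\<in>?P. 2 * (of_real (ln (real p) / (sqrt (real p) * L)) * fourier f (ln (real p) / L))\<^sup>2)
        = (\<Sum>p\<in>?P. of_real (2 / L) * (of_real (ln (real p) / real p) * h (ln (real p) / L)))"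
    proof (intro sum.cong refl)
      fix p assume "p \<in> ?P"
      have "(ln (real p) / (sqrt (real p) * L))\<^sup>2 = (1 / L) * (ln (real p) / real p) * (ln (real p) / L)"
        by (simp add: power2_eq_square)
      then show "2 * (of_real (ln (real p) / (sqrt (real p) * L)) * fourier f (ln (real p) / L))\<^sup>2
        = of_real (2 / L) * (of_real (ln (real p) / real p) * h (ln (real p) / L))"
        unfolding power_mult_distrib h_def of_real_power[symmetric] by (simp add: mult_ac)
    qed
    then have "(\<Sum>p\<in>?P. 2 * (of_real (ln (real p) / (sqrt (real p) * L)) * fourier f (ln (real p) / L))\<^sup>2) - sigma2 f
        = of_real (2 / L) * ((\<Sum>p\<in>?P. of_real (ln (real p) / real p) * h (ln (real p) / L)) - of_real L * integral {0..\<alpha>} h)"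
      using L by (simp only: sum_distrib_left[symmetric] sig) (simp add: right_diff_distrib)
    then show ?thesis
      using C[OF L] L by (simp only: norm_mult norm_of_real) (simp add: field_simps)
  qed
  then show ?thesis by blast
qed

section \<open>Averages of trigonometric polynomials\<close>

lemma norm_fourier_le: "cmod (fourier f u) \<le> (LINT x|lborel. \<bar>f x\<bar>)"
proof -
  have "cmod (fourier f u) \<le> (LINT x|lborel. cmod (complex_of_real (f x) * exp (- 2 * pi * \<i> * complex_of_real (x * u))))"
    unfolding fourier_def by (rule integral_norm_bound)
  also have "\<dots> = (LINT x|lborel. \<bar>f x\<bar>)"
    by (simp add: norm_mult norm_exp_eq_Re)
  finally show ?thesis .
qed

text \<open>The substitution \<open>\<tau> = T + H * y\<close> turns the average of a wave of
  frequency \<open>x\<close> into a phase times the integral of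
  \<open>w y * cis (H * x * y)\<close>; the factor \<open>2 * pi\<close> comes from the
  normalisation of \<open>fourier\<close>.\<close>

lemma wavg_trig_eval:
  assumes H: "H > 0" and w: "integrable lborel w"
  shows "wavg w T H (\<lambda>\<tau>. trig_eval \<tau> F)
       = (\<Sum>x\<in>freqs F. coef F x * cis (T * x) * fourier w (- (H * x / (2 * pi))))"
proof -
  have int: "integrable lborel (\<lambda>y. complex_of_real (w y) * cis (H * x * y))" for x
  proof (rule Bochner_Integration.integrable_bound[OF w])
    have "(\<lambda>y. cis (H * x * y)) \<in> borel_measurable borel"
      by (intro borel_measurable_continuous_onI continuous_intros)
    then show "(\<lambda>y. complex_of_real (w y) * cis (H * x * y)) \<in> borel_measurable lborel"
      using w by auto
  qed (auto simp: norm_mult)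
  have "wavg w T H (\<lambda>\<tau>. trig_eval \<tau> F)
      = \<bar>H\<bar> *\<^sub>R (LINT y|lborel. trig_eval (T + H * y) F * complex_of_real (w ((T + H * y - T) / H) / H))"
    unfolding wavg_def using H by (subst lborel_integral_real_affine[of H _ T]) auto
  also have "\<dots> = (LINT y|lborel. (\<Sum>x\<in>freqs F. coef F x * cis (T * x) * (complex_of_real (w y) * cis (H * x * y))))"
    unfolding integral_scaleR_right[symmetric]
    using H by (intro Bochner_Integration.integral_cong refl)
      (simp add: trig_eval_def scaleR_conv_of_real sum_distrib_left sum_distrib_right ring_distribs
                 cis_mult[symmetric] mult_ac)
  also have "\<dots> = (\<Sum>x\<in>freqs F. LINT y|lborel. coef F x * cis (T * x) * (complex_of_real (w y) * cis (H * x * y)))"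
    by (intro Bochner_Integration.integral_sum integrable_mult_right int)
  also have "\<dots> = (\<Sum>x\<in>freqs F. coef F x * cis (T * x) * (LINT y|lborel. complex_of_real (w y) * cis (H * x * y)))"
    by (simp only: integral_mult_right_zero)
  also have "\<dots> = (\<Sum>x\<in>freqs F. coef F x * cis (T * x) * fourier w (- (H * x / (2 * pi))))"
    unfolding fourier_def cis_conv_exp by (simp add: mult_ac)
  finally show ?thesis .
qed

text \<open>For \<open>a > b\<close> the difference is at least
  \<open>ln ((b + 1) / b) \<ge> 1 / (b + 1) \<ge> 1 / (2 * b)\<close>, and the smaller factor
  \<open>b\<close> is at most \<open>sqrt Y\<close>. The other order follows by symmetry.\<close>

lemma ln_ratio_separated:
  fixes a b :: nat
  assumes "a > 0" "b > 0" "real a * real b \<le> Y" "ln (real a) \<noteq> ln (real b)"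
  shows "\<bar>ln (real a) - ln (real b)\<bar> \<ge> 1 / (2 * sqrt Y)"
proof -
  have *: "ln (real a) - ln (real b) \<ge> 1 / (2 * sqrt Y)" if "a > b" "b > 0" "real a * real b \<le> Y" for a b :: nat
  proof -
    have "real b * real b \<le> real a * real b" using that by (intro mult_right_mono) auto
    then have "real b * real b \<le> Y" using that by linarith
    then have "real b \<le> sqrt Y" by (intro real_le_rsqrt) (simp add: power2_eq_square)
    moreover from this have "0 < sqrt Y" using that by linarith
    ultimately have "1 / (2 * sqrt Y) \<le> 1 / (2 * real b)"
      using that by (intro divide_left_mono mult_pos_pos mult_left_mono) auto
    also have "\<dots> \<le> 1 / (real b + 1)" using that by (intro divide_left_mono) auto
    also have "\<dots> = 1 - real b / (real b + 1)" by (simp add: field_simps)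
    also have "\<dots> \<le> - ln (real b / (real b + 1))"
      using that ln_le_minus_one[of "real b / (real b + 1)"] by simp
    also have "\<dots> = ln (real b + 1) - ln (real b)" using that by (simp add: ln_div)
    also have "\<dots> \<le> ln (real a) - ln (real b)" using that by simp
    finally show ?thesis .
  qed
  have "a \<noteq> b" using assms by auto
  then show ?thesis
    using *[of b a] *[of a b] assms by (cases "a > b") (auto simp: mult.commute)
qed

text \<open>Transfers the error in the variance to its powers, one factor at a time;
  \<open>R \<ge> 1\<close> allows one common power of \<open>R\<close> for all terms.\<close>

lemma norm_power_diff_le:
  fixes z w :: complex
  assumes "cmod z \<le> R" "cmod w \<le> R" "R \<ge> 1"
  shows "cmod (z ^ k - w ^ k) \<le> real k * R ^ k * cmod (z - w)"
proof (induction k)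
  case (Suc k)
  have "z ^ Suc k - w ^ Suc k = z * (z ^ k - w ^ k) + (z - w) * w ^ k"
    by (simp add: algebra_simps)
  then have "cmod (z ^ Suc k - w ^ Suc k) \<le> cmod z * cmod (z ^ k - w ^ k) + cmod (z - w) * cmod w ^ k"
    by (metis norm_mult norm_power norm_triangle_ineq)
  also have "\<dots> \<le> R * (real k * R ^ k * cmod (z - w)) + cmod (z - w) * R ^ Suc k"
  proof (intro add_mono mult_mono Suc assms)
    have "cmod w ^ k \<le> R ^ k" using assms by (intro power_mono) auto
    also have "\<dots> \<le> R ^ Suc k" using assms by (intro power_increasing) auto
    finally show "cmod w ^ k \<le> R ^ Suc k" .
  qed (use assms in auto)
  also have "\<dots> = real (Suc k) * R ^ Suc k * cmod (z - w)" by (simp add: algebra_simps)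
  finally show ?case .
qed auto

section \<open>The oscillating term\<close>

text \<open>The bound \<open>M\<close> does not depend on \<open>L\<close>, so every estimate in
  this context shows its dependence on \<open>L\<close> explicitly.\<close>

locale osc_poly =
  fixes f :: "real \<Rightarrow> real" and \<alpha> L M :: real
  assumes \<alpha>_pos: "\<alpha> > 0" and L_ge_1: "L \<ge> 1"
    and vanish: "\<And>u. \<bar>u\<bar> \<ge> \<alpha> \<Longrightarrow> fourier f u = 0"
    and bound: "\<And>u. cmod (fourier f u) \<le> M"
begin

text \<open>Here \<open>L\<close> stands for \<open>ln T\<close>; for \<open>n > N\<close> the coefficient \<open>c n\<close> vanishes, so
  \<open>F p\<close> collects all powers of \<open>p\<close>.\<close>

definition N :: nat where "N = nat \<lfloor>exp (\<alpha> * L)\<rfloor>"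
definition P :: "nat set" where "P = {p. prime p \<and> ln (real p) \<le> \<alpha> * L}"
definition c :: "nat \<Rightarrow> complex" where
  "c n = - (mangoldt n / of_real (sqrt (real n) * L)) * fourier f (ln (real n) / L)"
definition G :: "nat \<Rightarrow> real \<Rightarrow>\<^sub>0 complex" where
  "G n = wave (ln (real n)) (c n) + wave (- ln (real n)) (c n)"
definition F :: "nat \<Rightarrow> real \<Rightarrow>\<^sub>0 complex" where
  "F p = (\<Sum>k=1..N. G (p ^ k))"
definition X :: "real \<Rightarrow>\<^sub>0 complex" where
  "X = (\<Sum>p\<in>P. F p)"

lemma M_nonneg: "M \<ge> 0"
  using bound[of 0] norm_ge_zero order_trans by blast

lemma N_iff: "n > 0 \<Longrightarrow> n \<le> N \<longleftrightarrow> ln (real n) \<le> \<alpha> * L"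
proof -
  assume n: "n > 0"
  have "ln (real n) \<le> \<alpha> * L \<longleftrightarrow> real n \<le> exp (\<alpha> * L)"
    using n ln_le_cancel_iff[of "real n" "exp (\<alpha> * L)"] by simp
  also have "\<dots> \<longleftrightarrow> n \<le> N" unfolding N_def by (simp add: le_nat_iff le_floor_iff)
  finally show ?thesis by simp
qed

lemma N_pos: "N \<ge> 1"
  using N_iff[of 1] \<alpha>_pos L_ge_1 by simp

lemma P_eq: "P = {p. prime p \<and> p \<le> N}"
  unfolding P_def using N_iff prime_gt_0_nat by blast

lemma finite_P: "finite P"
  unfolding P_eq by simp

lemma prime_of_P: "p \<in> P \<Longrightarrow> prime p \<and> p \<ge> 2"
  unfolding P_eq using prime_ge_2_nat by blast

lemma c_eq_0: "n > N \<Longrightarrow> c n = 0"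
proof -
  assume n: "n > N"
  then have "ln (real n) \<ge> \<alpha> * L" using N_iff[of n] by simp
  then have "ln (real n) / L \<ge> \<alpha>" using L_ge_1 by (simp add: field_simps)
  then have "fourier f (ln (real n) / L) = 0" by (intro vanish) linarith
  then show ?thesis unfolding c_def by simp
qed

lemma G_eq_0: "n > N \<Longrightarrow> G n = 0" "\<not> primepow n \<Longrightarrow> G n = 0"
  by (auto simp: G_def c_eq_0) (simp add: c_def mangoldt_def)

lemma X_eq: "X = (\<Sum>n\<le>N. G n)"
  unfolding X_def F_def P_eq
  by (rule sum_primepow_decompose[symmetric]) (auto simp: G_eq_0)

text \<open>The infinite sum is really finite, since the transform vanishes for
  \<open>n > N\<close>; the indices 0 and 1 can be included because their von Mangoldt value is
  0.\<close>

lemma N_osc_eq: "N_osc f (exp L) \<tau> = trig_eval \<tau> X"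
proof -
  let ?t = "\<lambda>n. (mangoldt n / complex_of_real (sqrt (real n))) * fourier f (ln (real n) / L) *
        (exp (\<i> * complex_of_real (\<tau> * ln (real n))) + exp (- \<i> * complex_of_real (\<tau> * ln (real n))))"
  have t: "- (1 / complex_of_real L) * ?t n = trig_eval \<tau> (G n)" for n
    using L_ge_1 by (simp add: G_def trig_eval_add c_def cis_conv_exp field_simps) (simp add: add_divide_distrib)
  have "(\<Sum>\<^sub>\<infinity>n\<in>{2::nat..}. ?t n) = (\<Sum>\<^sub>\<infinity>n\<in>{..N}. ?t n)"
  proof (rule infsum_cong_neutral)
    fix n assume "n \<in> {2..} - {..N}"
    then have "ln (real n) / L \<ge> \<alpha>" using N_iff[of n] L_ge_1 by (simp add: field_simps)
    then have "fourier f (ln (real n) / L) = 0" by (intro vanish) linarith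
    then show "?t n = 0" by simp
  next
    fix n assume "n \<in> {..N} - {2..}"
    then have "n = 0 \<or> n = 1" by auto
    then show "?t n = 0" by auto
  qed auto
  also have "\<dots> = (\<Sum>n\<le>N. ?t n)" by (rule infsum_finite) auto
  finally have "N_osc f (exp L) \<tau> = - (1 / complex_of_real L) * (\<Sum>n\<le>N. ?t n)"
    unfolding N_osc_def ln_exp by (rule arg_cong)
  also have "\<dots> = (\<Sum>n\<le>N. trig_eval \<tau> (G n))"
    unfolding sum_distrib_left by (intro sum.cong refl t)
  finally show ?thesis by (simp add: X_eq trig_eval_sum)
qed

lemma freqs_G: "freqs (G n) \<subseteq> {ln (real n), - ln (real n)}"
  unfolding G_def using keys_add[of "wave (ln (real n)) (c n)" "wave (- ln (real n)) (c n)"]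
  by (auto split: if_splits)

lemma freqs_F: 
  assumes "p \<in> P"
  shows "freqs (F p) \<subseteq> prime_freqs p"
  unfolding F_def
proof (rule freqs_sum)
  fix k assume "k \<in> {1..N}"
  have p: "p > 0" using prime_of_P[OF assms] by auto
  have "ln (real (p ^ k)) = of_int (int k) * ln (real p)" "- ln (real (p ^ k)) = of_int (- int k) * ln (real p)"
    using p by (simp_all add: ln_realpow)
  then have "ln (real (p ^ k)) \<in> prime_freqs p" "- ln (real (p ^ k)) \<in> prime_freqs p"
    unfolding prime_freqs_def by blast+
  then show "freqs (G (p ^ k)) \<subseteq> prime_freqs p" using freqs_G by blast
qed

lemma moment_fps_X: "moment_fps X = (\<Prod>p\<in>P. moment_fps (F p))"
  unfolding X_def using prime_of_P by (intro moment_fps_sum finite_P freqs_F) auto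

text \<open>Each further factor multiplies some \<open>n \<le> exp (\<alpha> * L)\<close> into
  either \<open>a\<close> or \<open>b\<close>. Tracking the product \<open>a * b\<close> instead of
  each number separately is what yields the exponent \<open>m * \<alpha> / 2\<close> in the
  separation of frequencies.\<close>

lemma freqs_X_power:
  "freqs (X ^ m) \<subseteq> {ln (real a) - ln (real b) |a b. a > 0 \<and> b > 0 \<and> real a * real b \<le> exp (\<alpha> * L) ^ m}"
proof (induction m)
  case 0
  show ?case by (auto intro!: exI[of _ 1])
next
  case (Suc m)
  show ?case
  proof
    fix z assume "z \<in> freqs (X ^ Suc m)"
    then obtain x y where xy: "z = x + y" "x \<in> freqs X" "y \<in> freqs (X ^ m)"
      using keys_mult[of X "X ^ m"] by auto
    then obtain a b where y: "y = ln (real a) - ln (real b)" "a > 0" "b > 0"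
      "real a * real b \<le> exp (\<alpha> * L) ^ m" using Suc by blast
    have "freqs X \<subseteq> (\<Union>n\<in>{1..N}. {ln (real n), - ln (real n)})"
      unfolding X_eq
    proof (rule freqs_sum)
      fix n assume "n \<in> {..N}"
      \<comment> \<open>The index 0 is harmless: it is not a prime power, so
        \<open>G 0 = 0\<close>.\<close>
      then show "freqs (G n) \<subseteq> (\<Union>n\<in>{1..N}. {ln (real n), - ln (real n)})"
        using freqs_G[of n] G_eq_0(2)[of n] by (cases "n = 0") (auto, force)
    qed
    then have "x \<in> (\<Union>n\<in>{1..N}. {ln (real n), - ln (real n)})" using xy by blast
    then obtain n where n: "1 \<le> n" "n \<le> N" "x = ln (real n) \<or> x = - ln (real n)" by auto
    have "real n \<le> exp (\<alpha> * L)"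
      using n N_iff[of n] ln_le_cancel_iff[of "real n" "exp (\<alpha> * L)"] by simp
    then have le: "real n * (real a * real b) \<le> exp (\<alpha> * L) ^ Suc m"
      unfolding power_Suc using y by (intro mult_mono) auto
    from n(3) show "z \<in> {ln (real a) - ln (real b) |a b. a > 0 \<and> b > 0 \<and> real a * real b \<le> exp (\<alpha> * L) ^ Suc m}"
    proof
      assume "x = ln (real n)"
      then have "z = ln (real (n * a)) - ln (real b)" using xy y n by (simp add: ln_mult)
      then show ?thesis using y n le
        by (intro CollectI exI[of _ "n * a"] exI[of _ b]) (auto simp: mult_ac)
    next
      assume "x = - ln (real n)"
      then have "z = ln (real a) - ln (real (n * b))" using xy y n by (simp add: ln_mult)
      then show ?thesis using y n le
        by (intro CollectI exI[of _ a] exI[of _ "n * b"]) (auto simp: mult_ac)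
    qed
  qed
qed

text \<open>Majorant of the norm of \<open>F p\<close>: by \<open>norm_c\<close> the powers of \<open>p\<close> contribute a geometric series
  with ratio at most 3/4.\<close>

definition q :: "nat \<Rightarrow> real" where "q p = 8 * M * ln (real p) / (L * sqrt (real p))"

lemma norm_c:
  assumes "p \<in> P" "k > 0"
  shows "cmod (c (p ^ k)) \<le> M * ln (real p) / L * (1 / sqrt (real p)) ^ k"
proof -
  have p: "prime p" "p \<ge> 2" using prime_of_P[OF assms(1)] by auto
  have "cmod (c (p ^ k)) = ln (real p) / (sqrt (real p) ^ k * L) * cmod (fourier f (ln (real (p ^ k)) / L))"
    using p L_ge_1 assms by (simp add: c_def norm_mult norm_divide real_sqrt_power norm_power)
  also have "\<dots> \<le> ln (real p) / (sqrt (real p) ^ k * L) * M"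
    using p L_ge_1 by (intro mult_left_mono bound) auto
  finally show ?thesis by (simp add: power_one_over field_simps)
qed

lemma inverse_sqrt_prime_le: "p \<in> P \<Longrightarrow> 1 / sqrt (real p) \<le> 3 / 4"
proof -
  assume "p \<in> P"
  then have "real p \<ge> 2" using prime_of_P by fastforce
  then have "4 / 3 \<le> sqrt (real p)" by (intro real_le_rsqrt) (simp add: power2_eq_square)
  then have "1 / sqrt (real p) \<le> 1 / (4 / 3)" using \<open>real p \<ge> 2\<close> by (intro divide_left_mono) auto
  then show ?thesis by simp
qed

text \<open>The 8 is a factor 2 for the two waves in \<open>G\<close> times 4 for a geometric series
  of ratio at most 3/4. The case \<open>j = 1\<close> bounds \<open>F p\<close>;
  \<open>j = 2\<close> isolates the proper prime powers.\<close>

lemma trig_norm_tail: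
  assumes "p \<in> P" "j > 0"
  shows "trig_norm (\<Sum>k=j..N. G (p ^ k)) \<le> 8 * M * ln (real p) / L * (1 / sqrt (real p)) ^ j"
proof -
  have p: "prime p" "p \<ge> 2" using prime_of_P[OF assms(1)] by auto
  have lnp: "ln (real p) \<ge> 0" using p by simp
  let ?x = "1 / sqrt (real p)"
  have x: "0 \<le> ?x" "?x \<le> 3 / 4" using inverse_sqrt_prime_le assms by auto
  have "trig_norm (\<Sum>k=j..N. G (p ^ k)) \<le> (\<Sum>k=j..N. trig_norm (G (p ^ k)))" by (rule trig_norm_sum)
  also have "\<dots> \<le> (\<Sum>k=j..N. 2 * (M * ln (real p) / L * ?x ^ k))"
  proof (intro sum_mono)
    fix k assume "k \<in> {j..N}"
    then have "k > 0" using assms by auto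
    have "trig_norm (G (p ^ k)) \<le> 2 * cmod (c (p ^ k))"
      unfolding G_def by (rule order_trans[OF trig_norm_add]) simp
    then show "trig_norm (G (p ^ k)) \<le> 2 * (M * ln (real p) / L * ?x ^ k)"
      using norm_c[OF assms(1) \<open>k > 0\<close>] by linarith
  qed
  also have "\<dots> = 2 * M * ln (real p) / L * (\<Sum>k=j..N. ?x ^ k)"
    by (simp add: sum_distrib_left mult_ac)
  also have "\<dots> \<le> 2 * M * ln (real p) / L * (?x ^ j / (1 - ?x))"
    using x L_ge_1 M_nonneg lnp by (intro mult_left_mono sum_geometric_tail_le) auto
  also have "\<dots> \<le> 2 * M * ln (real p) / L * (?x ^ j / (1 / 4))"
    using x L_ge_1 M_nonneg lnp by (intro mult_left_mono divide_left_mono) auto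
  finally show ?thesis by simp
qed

lemma trig_norm_F: "p \<in> P \<Longrightarrow> trig_norm (F p) \<le> q p"
  using trig_norm_tail[of p 1] unfolding F_def q_def by simp

lemma q_nonneg: "p \<in> P \<Longrightarrow> q p \<ge> 0"
  unfolding q_def using prime_of_P[of p] M_nonneg L_ge_1 by simp

lemma q_le: "p \<in> P \<Longrightarrow> q p \<le> 16 * M"
proof -
  assume "p \<in> P"
  then have p: "p \<ge> 2" using prime_of_P by auto
  have "ln (real p) = 2 * ln (sqrt (real p))" using p by (simp add: ln_sqrt)
  also have "\<dots> \<le> 2 * (sqrt (real p) - 1)" using p by (intro mult_left_mono ln_le_minus_one) auto
  also have "\<dots> \<le> 2 * sqrt (real p)" by simp
  also have "\<dots> \<le> 2 * (L * sqrt (real p))" using L_ge_1 by (simp add: mult_right_mono[of 1 L, simplified])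
  finally have "8 * M * ln (real p) \<le> 8 * M * (2 * (L * sqrt (real p)))"
    using M_nonneg by (intro mult_left_mono) auto
  then show ?thesis unfolding q_def using p L_ge_1 by (simp add: field_simps)
qed

lemma coef_F: "p \<in> P \<Longrightarrow> coef (F p) 0 = 0"
  unfolding F_def lookup_sum
proof (intro sum.neutral ballI)
  fix k assume pk: "p \<in> P" "k \<in> {1..N}"
  then have "ln (real (p ^ k)) \<noteq> 0" using prime_of_P[of p] by (simp add: ln_realpow)
  then show "coef (G (p ^ k)) 0 = 0" by (simp add: G_def lookup_add lookup_single when_def)
qed

lemma moment_fps_F:
  assumes "p \<in> P"
  shows "fps_nth (moment_fps (F p)) 0 = 1" "fps_nth (moment_fps (F p)) 1 = 0"
    "cmod (fps_nth (moment_fps (F p)) s) \<le> q p ^ s"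
proof -
  show "fps_nth (moment_fps (F p)) 0 = 1" "fps_nth (moment_fps (F p)) 1 = 0"
    using coef_F[OF assms] by (simp_all add: moment_fps_def)
  have "cmod (fps_nth (moment_fps (F p)) s) = cmod (coef (F p ^ s) 0) / fact s"
    by (simp add: moment_fps_def norm_divide)
  also have "\<dots> \<le> cmod (coef (F p ^ s) 0) / 1" by (intro divide_left_mono) auto
  also have "\<dots> \<le> trig_norm (F p ^ s)" by (simp add: norm_coef_le)
  also have "\<dots> \<le> trig_norm (F p) ^ s" by (rule trig_norm_power)
  also have "\<dots> \<le> q p ^ s" by (intro power_mono trig_norm_F assms trig_norm_nonneg)
  finally show "cmod (fps_nth (moment_fps (F p)) s) \<le> q p ^ s" .
qed

lemma second_moment_F:
  assumes "p \<in> P"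
  shows "cmod (2 * fps_nth (moment_fps (F p)) 2 - 2 * (c p)\<^sup>2)
      \<le> 128 * M\<^sup>2 / L\<^sup>2 * (ln (real p) ^ 2 / (real p * sqrt (real p)))"
proof -
  have p: "prime p" "p \<ge> 2" using prime_of_P[OF assms(1)] by auto
  have lnp: "ln (real p) > 0" using p by simp
  have FG: "F p = G p + (\<Sum>k=2..N. G (p ^ k))"
    unfolding F_def using N_pos by (subst sum.atLeast_Suc_atMost) (auto simp: numeral_2_eq_2)
  have G2: "coef (G p ^ 2) 0 = 2 * (c p)\<^sup>2"
    using lnp by (simp add: G_def power2_eq_square ring_distribs mult_single lookup_add lookup_single when_def)
      (simp only: mult_2 lookup_add lookup_single_eq)
  have "2 * fps_nth (moment_fps (F p)) 2 - 2 * (c p)\<^sup>2 = coef (F p ^ 2 - G p ^ 2) 0"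
    by (simp add: moment_fps_def G2 lookup_minus)
  also have "F p ^ 2 - G p ^ 2 = (\<Sum>k=2..N. G (p ^ k)) * (F p + G p)"
    unfolding FG by (simp add: power2_eq_square algebra_simps)
  finally have "cmod (2 * fps_nth (moment_fps (F p)) 2 - 2 * (c p)\<^sup>2)
      \<le> trig_norm ((\<Sum>k=2..N. G (p ^ k)) * (F p + G p))" by (simp only: norm_coef_le)
  also have "\<dots> \<le> trig_norm (\<Sum>k=2..N. G (p ^ k)) * trig_norm (F p + G p)" by (rule trig_norm_mult)
  also have "\<dots> \<le> (8 * M * ln (real p) / L * (1 / sqrt (real p)) ^ 2) * (q p + q p)"
  proof (intro mult_mono trig_norm_nonneg trig_norm_tail assms)
    have "trig_norm (G p) \<le> 2 * cmod (c p)"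
      unfolding G_def by (rule order_trans[OF trig_norm_add]) simp
    also have "\<dots> \<le> 2 * (M * ln (real p) / L * (1 / sqrt (real p)))"
      using norm_c[OF assms, of 1] by simp
    also have "\<dots> \<le> 8 * (M * ln (real p) / L * (1 / sqrt (real p)))"
      using M_nonneg L_ge_1 lnp by (intro mult_right_mono) auto
    finally have "trig_norm (G p) \<le> q p" by (simp add: q_def)
    then show "trig_norm (F p + G p) \<le> q p + q p"
      using trig_norm_add[of "F p" "G p"] trig_norm_F[OF assms] by linarith
    show "0 \<le> 8 * M * ln (real p) / L * (1 / sqrt (real p)) ^ 2"
      using M_nonneg L_ge_1 lnp by simp
  qed auto
  also have "\<dots> = 128 * M\<^sup>2 / L\<^sup>2 * (ln (real p) ^ 2 / (real p * sqrt (real p)))"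
    using p by (simp add: q_def power2_eq_square field_simps)
  finally show ?thesis .
qed

lemma sum_q_cubed: "(\<Sum>p\<in>P. q p ^ 3) \<le> 512 * M ^ 3 * ln_power_const 3 / L"
proof -
  have "(\<Sum>p\<in>P. q p ^ 3) = 512 * M ^ 3 / L ^ 3 * (\<Sum>p\<in>P. ln (real p) ^ 3 / (real p * sqrt (real p)))"
    unfolding sum_distrib_left q_def by (intro sum.cong refl) (simp add: power3_eq_cube field_simps)
  also have "\<dots> \<le> 512 * M ^ 3 / L ^ 3 * ln_power_const 3"
    using M_nonneg L_ge_1 by (intro mult_left_mono sum_ln_power_over_le finite_P) auto
  also have "\<dots> \<le> 512 * M ^ 3 / L * ln_power_const 3"
  proof (intro mult_right_mono divide_left_mono)
    show "0 \<le> ln_power_const 3" using sum_ln_power_over_le[of "{}" 3] by simp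
    show "L \<le> L ^ 3" using L_ge_1 by (simp add: self_le_power)
  qed (use M_nonneg L_ge_1 in auto)
  finally show ?thesis by simp
qed

lemma sum_q_squared:
  assumes C: "(\<Sum>p\<in>P. ln (real p) / real p) \<le> \<alpha> * L + C" "C \<ge> 0"
  shows "(\<Sum>p\<in>P. q p ^ 2) \<le> 64 * M\<^sup>2 * \<alpha> * (\<alpha> + C)"
proof -
  have "(\<Sum>p\<in>P. q p ^ 2) = 64 * M\<^sup>2 / L\<^sup>2 * (\<Sum>p\<in>P. ln (real p) * (ln (real p) / real p))"
    unfolding sum_distrib_left q_def by (intro sum.cong refl) (simp add: power2_eq_square field_simps)
  also have "\<dots> \<le> 64 * M\<^sup>2 / L\<^sup>2 * (\<Sum>p\<in>P. \<alpha> * L * (ln (real p) / real p))"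
  proof (intro mult_left_mono sum_mono mult_right_mono)
    fix p assume p: "p \<in> P"
    show "ln (real p) \<le> \<alpha> * L" using p by (simp add: P_def)
    show "0 \<le> ln (real p) / real p" using prime_of_P[OF p] by simp
  qed auto
  also have "\<dots> = 64 * M\<^sup>2 / L\<^sup>2 * (\<alpha> * L * (\<Sum>p\<in>P. ln (real p) / real p))"
    by (simp add: sum_distrib_left)
  also have "\<dots> \<le> 64 * M\<^sup>2 / L\<^sup>2 * (\<alpha> * L * (\<alpha> * L + C * L))"
  proof (intro mult_left_mono)
    have "C \<le> C * L" using C L_ge_1 by (simp add: mult_left_mono[of 1 L, simplified])
    then show "(\<Sum>p\<in>P. ln (real p) / real p) \<le> \<alpha> * L + C * L" using C by linarith
  qed (use \<alpha>_pos L_ge_1 in auto)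
  also have "\<dots> = 64 * M\<^sup>2 * \<alpha> * (\<alpha> + C)"
    using L_ge_1 by (simp add: power2_eq_square field_simps)
  finally show ?thesis .
qed

lemma wavg_N_osc_power:
  assumes H: "H > 0" and w: "integrable lborel w" "(LINT x|lborel. w x) = 1"
    and B: "\<And>u. \<bar>u\<bar> > B \<Longrightarrow> fourier w u = 0"
    and big: "H * exp (- (\<alpha> * L * real m / 2)) > 4 * pi * B"
  shows "wavg w (exp L) H (\<lambda>\<tau>. N_osc f (exp L) \<tau> ^ m) = coef (X ^ m) 0"
proof -
  have w0: "fourier w 0 = 1" using w by (simp add: fourier_def)
  have "wavg w (exp L) H (\<lambda>\<tau>. N_osc f (exp L) \<tau> ^ m) = wavg w (exp L) H (\<lambda>\<tau>. trig_eval \<tau> (X ^ m))"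
    by (simp add: N_osc_eq trig_eval_power)
  also have "\<dots> = (\<Sum>x\<in>freqs (X ^ m). coef (X ^ m) x * cis (exp L * x) * fourier w (- (H * x / (2 * pi))))"
    by (rule wavg_trig_eval[OF H w(1)])
  also have "\<dots> = (\<Sum>x\<in>freqs (X ^ m). if x = 0 then coef (X ^ m) x else 0)"
  proof (intro sum.cong refl)
    fix x assume x: "x \<in> freqs (X ^ m)"
    show "coef (X ^ m) x * cis (exp L * x) * fourier w (- (H * x / (2 * pi))) = (if x = 0 then coef (X ^ m) x else 0)"
    proof (cases "x = 0")
      case True
      then show ?thesis by (simp add: w0)
    next
      case False
      obtain a b where ab: "x = ln (real a) - ln (real b)" "a > 0" "b > 0"
        "real a * real b \<le> exp (\<alpha> * L) ^ m" using x freqs_X_power[of m] by blast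
      have "sqrt (exp (\<alpha> * L) ^ m) = exp (\<alpha> * L * real m / 2)"
      proof (rule real_sqrt_unique)
        show "exp (\<alpha> * L * real m / 2) ^ 2 = exp (\<alpha> * L) ^ m"
          by (simp add: mult_ac flip: exp_of_nat_mult exp_double)
      qed auto
      then have "\<bar>x\<bar> \<ge> 1 / (2 * exp (\<alpha> * L * real m / 2))"
        using ln_ratio_separated[OF ab(2-4)] ab(1) False by simp
      then have "\<bar>x\<bar> \<ge> exp (- (\<alpha> * L * real m / 2)) / 2" by (simp add: exp_minus field_simps)
      then have "H * (exp (- (\<alpha> * L * real m / 2)) / 2) \<le> H * \<bar>x\<bar>"
        using H by (intro mult_left_mono) auto
      then have "H * \<bar>x\<bar> > 2 * pi * B" using big by simp
      then have "H * \<bar>x\<bar> / (2 * pi) > B" using pi_gt_zero by (subst pos_less_divide_eq) (auto simp: mult_ac)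
      then have "\<bar>- (H * x / (2 * pi))\<bar> > B" using H by (simp add: abs_mult)
      then show ?thesis using B False by simp
    qed
  qed
  also have "\<dots> = coef (X ^ m) 0" by (auto simp: in_keys_iff)
  finally show ?thesis .
qed

end

theorem theorem7:
  fixes a \<alpha> :: real and f w :: "real \<Rightarrow> real" and m :: nat
  assumes a_pos: "0 < a" and a_le: "a \<le> 1"
    and alpha_pos: "\<alpha> > 0"
    and f_int: "integrable lborel f"
    and f_even: "\<And>x. f (- x) = f x"
    and f_smooth: "smooth_fun (fourier f)"
    and f_supp: "supp (fourier f) \<subseteq> {- \<alpha><..<\<alpha>}"
    and w_nonneg: "\<And>x. w x \<ge> 0"
    and w_int: "integrable lborel w"
    and w_one: "(LINT x|lborel. w x) = 1"
    and w_supp: "bounded (supp (fourier w))"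
    and m_ge: "2 \<le> m" and m_lt: "real m < 2 * a / \<alpha>"
  shows "\<exists>C. \<forall>\<^sub>F T in at_top.
           cmod (wavg w T (T powr a) (\<lambda>\<tau>. (N_osc f T \<tau>) ^ m)
                 - (if even m
                    then complex_of_real (fact m / (fact (m div 2) * 2 ^ (m div 2))) * (sigma2 f) ^ (m div 2)
                    else 0))
           \<le> C / ln T"
proof -
  have van: "fourier f u = 0" if "\<bar>u\<bar> \<ge> \<alpha>" for u
  proof (rule ccontr)
    assume "fourier f u \<noteq> 0"
    then have "u \<in> supp (fourier f)" unfolding supp_def by (intro subsetD[OF closure_subset]) auto
    then have "u \<in> {- \<alpha><..<\<alpha>}" using f_supp by blast
    then show False using that by auto
  qed
  obtain B where B: "\<And>u. \<bar>u\<bar> > B \<Longrightarrow> fourier w u = 0"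
  proof -
    obtain B where "\<And>u. u \<in> supp (fourier w) \<Longrightarrow> \<bar>u\<bar> \<le> B"
      using w_supp unfolding bounded_iff by auto
    then have "fourier w u = 0" if "\<bar>u\<bar> > B" for u
      using that closure_subset[of "{u. fourier w u \<noteq> 0}"] unfolding supp_def by fastforce
    then show ?thesis using that by blast
  qed
  define M where "M = (LINT x|lborel. \<bar>f x\<bar>)"
  have \<alpha>1: "\<alpha> \<le> 1"
  proof -
    have "2 < 2 * a / \<alpha>" using m_ge m_lt by linarith
    then show ?thesis using alpha_pos a_le by (simp add: field_simps)
  qed
  have gap: "a - \<alpha> * real m / 2 > 0" using m_lt alpha_pos by (simp add: field_simps)
  obtain C1 where C1: "\<And>L. L > 0 \<Longrightarrow> cmod ((\<Sum>p | prime p \<and> ln (real p) \<le> \<alpha> * L.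
            2 * (of_real (ln (real p) / (sqrt (real p) * L)) * fourier f (ln (real p) / L))\<^sup>2)
            - sigma2 f) \<le> C1 / L"
    using fourier_variance_over_primes[OF alpha_pos \<alpha>1 f_even f_smooth van] by blast
  obtain C2 where C2: "C2 \<ge> 0" "\<And>t. t \<ge> 0 \<Longrightarrow> \<bar>(\<Sum>p | prime p \<and> ln (real p) \<le> t. ln (real p) / real p) - t\<bar> \<le> C2"
    using mertens_first_real by blast
  define K where "K = 2 * real (m + 1) * (1 + 16 * M) ^ m"
  define A1 where "A1 = K * (512 * M ^ 3 * ln_power_const 3) * exp (K * (64 * M\<^sup>2 * \<alpha> * (\<alpha> + C2)))"
  define A2 where "A2 = \<bar>C1\<bar> + 128 * M\<^sup>2 * ln_power_const 2"
  define R where "R = cmod (sigma2 f) + A2 + 1"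
  define A3 where "A3 = fact m * (real (m div 2) * R ^ (m div 2) * A2)"
  have lpc: "ln_power_const s \<ge> 0" for s using sum_ln_power_over_le[of "{}" s] by simp
  have A2: "A2 \<ge> 0" unfolding A2_def using lpc by simp
  have main: "cmod (wavg w T (T powr a) (\<lambda>\<tau>. (N_osc f T \<tau>) ^ m)
                 - (if even m
                    then complex_of_real (fact m / (fact (m div 2) * 2 ^ (m div 2))) * (sigma2 f) ^ (m div 2)
                    else 0))
           \<le> (fact m * A1 + A3) / ln T"
    if T: "ln T \<ge> 1" "T > 0" "T powr (a - \<alpha> * real m / 2) > 4 * pi * B" for T
  proof -
    define L where "L = ln T"
    have TL: "T = exp L" using T by (simp add: L_def)
    interpret osc_poly f \<alpha> L M
      using alpha_pos T van by unfold_locales (auto simp: L_def M_def norm_fourier_le)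
    let ?V = "\<Sum>p\<in>P. 2 * fps_nth (moment_fps (F p)) 2"
    have avg: "wavg w T (T powr a) (\<lambda>\<tau>. (N_osc f T \<tau>) ^ m) = fact m * fps_nth (moment_fps X) m"
    proof -
      have "T powr a * exp (- (\<alpha> * L * real m / 2)) = T powr (a - \<alpha> * real m / 2)"
        by (simp add: TL powr_def exp_add[symmetric] algebra_simps)
      then have "wavg w T (T powr a) (\<lambda>\<tau>. (N_osc f T \<tau>) ^ m) = coef (X ^ m) 0"
        unfolding TL using T(3) by (intro wavg_N_osc_power w_int w_one B) (auto simp: TL)
      then show ?thesis by (simp add: moment_fps_def)
    qed
    have d1: "cmod (fps_nth (moment_fps X) m - fps_nth (gauss_fps ?V) m) \<le> A1 / L"
    proof -
      have K0: "K \<ge> 0" unfolding K_def using M_nonneg by simp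
      have "cmod (fps_nth (moment_fps X) m - fps_nth (gauss_fps ?V) m)
          \<le> K * (\<Sum>p\<in>P. q p ^ 3) * exp (K * (\<Sum>p\<in>P. q p ^ 2))"
        unfolding moment_fps_X K_def
        by (rule fps_prod_near_gauss) (auto simp: finite_P q_nonneg q_le moment_fps_F simp del: One_nat_def)
      also have "\<dots> \<le> K * (512 * M ^ 3 * ln_power_const 3 / L) * exp (K * (64 * M\<^sup>2 * \<alpha> * (\<alpha> + C2)))"
      proof -
        have "(\<Sum>p\<in>P. ln (real p) / real p) \<le> \<alpha> * L + C2"
          using C2(2)[of "\<alpha> * L"] \<alpha>_pos L_ge_1 unfolding P_def by simp
        then have "(\<Sum>p\<in>P. q p ^ 2) \<le> 64 * M\<^sup>2 * \<alpha> * (\<alpha> + C2)"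
          by (rule sum_q_squared) (rule C2(1))
        then show ?thesis
          using K0 sum_q_cubed M_nonneg lpc[of 3] L_ge_1
          by (intro mult_mono) (auto intro!: mult_left_mono sum_nonneg q_nonneg)
      qed
      finally show ?thesis by (simp add: A1_def)
    qed
    have dV: "cmod (?V - sigma2 f) \<le> A2 / L"
    proof -
      have c: "(c p)\<^sup>2 = (of_real (ln (real p) / (sqrt (real p) * L)) * fourier f (ln (real p) / L))\<^sup>2" if "p \<in> P" for p
        using prime_of_P[OF that] by (simp add: c_def)
      have "cmod (?V - (\<Sum>p\<in>P. 2 * (c p)\<^sup>2)) \<le> (\<Sum>p\<in>P. cmod (2 * fps_nth (moment_fps (F p)) 2 - 2 * (c p)\<^sup>2))"
        unfolding sum_subtractf[symmetric] by (rule norm_sum)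
      also have "\<dots> \<le> (\<Sum>p\<in>P. 128 * M\<^sup>2 / L\<^sup>2 * (ln (real p) ^ 2 / (real p * sqrt (real p))))"
        by (intro sum_mono second_moment_F)
      also have "\<dots> \<le> 128 * M\<^sup>2 / L\<^sup>2 * ln_power_const 2"
        unfolding sum_distrib_left[symmetric] by (intro mult_left_mono sum_ln_power_over_le finite_P) auto
      also have "\<dots> \<le> 128 * M\<^sup>2 / L * ln_power_const 2"
        using L_ge_1 lpc by (intro mult_right_mono divide_left_mono) (auto simp: self_le_power)
      finally have 1: "cmod (?V - (\<Sum>p\<in>P. 2 * (c p)\<^sup>2)) \<le> 128 * M\<^sup>2 / L * ln_power_const 2" .
      have "cmod ((\<Sum>p\<in>P. 2 * (c p)\<^sup>2) - sigma2 f) \<le> C1 / L"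
        using C1[of L] L_ge_1 c unfolding P_def[symmetric] by simp
      also have "\<dots> \<le> \<bar>C1\<bar> / L" using L_ge_1 by (intro divide_right_mono) auto
      finally have 2: "cmod ((\<Sum>p\<in>P. 2 * (c p)\<^sup>2) - sigma2 f) \<le> \<bar>C1\<bar> / L" .
      have "cmod (?V - sigma2 f) \<le> 128 * M\<^sup>2 / L * ln_power_const 2 + \<bar>C1\<bar> / L"
        using norm_triangle_ineq[of "?V - (\<Sum>p\<in>P. 2 * (c p)\<^sup>2)" "(\<Sum>p\<in>P. 2 * (c p)\<^sup>2) - sigma2 f"] 1 2 by simp
      then show ?thesis by (simp add: A2_def add_divide_distrib)
    qed
    have d2: "cmod (fact m * fps_nth (gauss_fps ?V) m
        - (if even m then complex_of_real (fact m / (fact (m div 2) * 2 ^ (m div 2))) * (sigma2 f) ^ (m div 2) else 0)) \<le> A3 / L"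
    proof (cases "even m")
      case False
      then show ?thesis using A2 L_ge_1 by (simp add: gauss_fps_def A3_def R_def)
    next
      case True
      let ?k = "m div 2"
      let ?r = "fact m / (fact ?k * 2 ^ ?k) :: real"
      have r: "0 \<le> ?r" "?r \<le> fact m"
      proof -
        have "1 * 1 \<le> fact ?k * (2 ^ ?k :: real)" by (intro mult_mono) auto
        then have "?r \<le> fact m / 1" by (intro divide_left_mono) auto
        then show "?r \<le> fact m" by simp
      qed auto
      have A2L: "A2 / L \<le> A2" using A2 L_ge_1 by (simp add: field_simps mult_left_mono[of 1 L, simplified])
      have "fact m * fps_nth (gauss_fps ?V) m = of_real ?r * ?V ^ ?k"
        using True by (simp add: gauss_fps_def power_divide)
      then have "cmod (fact m * fps_nth (gauss_fps ?V) m - of_real ?r * sigma2 f ^ ?k)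
          = ?r * cmod (?V ^ ?k - sigma2 f ^ ?k)"
        using r(1) by (simp only: right_diff_distrib[symmetric] norm_mult norm_of_real abs_of_nonneg)
      also have "\<dots> \<le> fact m * (real ?k * R ^ ?k * cmod (?V - sigma2 f))"
      proof (intro mult_mono r norm_power_diff_le)
        show "cmod ?V \<le> R"
          using norm_triangle_ineq[of "?V - sigma2 f" "sigma2 f"] dV A2L unfolding R_def by simp
      qed (use A2 in \<open>auto simp: R_def\<close>)
      also have "\<dots> \<le> fact m * (real ?k * R ^ ?k * (A2 / L))"
        using dV A2 by (intro mult_left_mono) (auto simp: R_def)
      finally show ?thesis using True by (simp add: A3_def)
    qed
    have "cmod (fact m * fps_nth (moment_fps X) m - fact m * fps_nth (gauss_fps ?V) m) \<le> fact m * (A1 / L)"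
      unfolding right_diff_distrib[symmetric] norm_mult norm_fact by (intro mult_left_mono d1) simp
    then show ?thesis
      unfolding avg using d2
        norm_triangle_ineq[of "fact m * fps_nth (moment_fps X) m - fact m * fps_nth (gauss_fps ?V) m"
          "fact m * fps_nth (gauss_fps ?V) m
        - (if even m then complex_of_real (fact m / (fact (m div 2) * 2 ^ (m div 2))) * (sigma2 f) ^ (m div 2) else 0)"]
      unfolding L_def[symmetric] by (simp add: add_divide_distrib)
  qed
  have "\<forall>\<^sub>F T in at_top. ln T \<ge> (1::real)"
    using ln_at_top unfolding filterlim_at_top by blast
  moreover have "\<forall>\<^sub>F T in at_top. T > (0::real)" by (rule eventually_gt_at_top)
  moreover have "\<forall>\<^sub>F T in at_top. T powr (a - \<alpha> * real m / 2) > 4 * pi * B"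
  proof -
    have "filterlim (\<lambda>T::real. T powr b) at_top at_top" if "b > 0" for b
      using that by real_asymp
    then show ?thesis using gap unfolding filterlim_at_top_dense by blast
  qed
  ultimately have "\<forall>\<^sub>F T in at_top. cmod (wavg w T (T powr a) (\<lambda>\<tau>. (N_osc f T \<tau>) ^ m)
                 - (if even m
                    then complex_of_real (fact m / (fact (m div 2) * 2 ^ (m div 2))) * (sigma2 f) ^ (m div 2)
                    else 0))
           \<le> (fact m * A1 + A3) / ln T"
    by eventually_elim (rule main)
  then show ?thesis by blast
qed

end
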